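(* Let $(G,X)$ be a minimal topological dynamical system. Then the quotient map $\pi_1:(G,X)\to(G,X/\mathbf{NRP}^{[1]}(X))$ is the maximal abelian group factor of $(G,X)$. That is, $(G,X/\mathbf{NRP}^{[1]}(X))$ is an abelian group t.d.s., and if $\phi:(G,X)\to(G,K)$ is a factor map where $(G,K)$ is an abelian group t.d.s., then there exists a dynamical morphism $\psi:(G,X/\mathbf{NRP}^{[1]}(X))\to(G,K)$ such that $\phi=\psi\circ\pi_1$.
   Context: A topological dynamical system (t.d.s.) $(G,X)$ is a Hausdorff topological group $G$ acting continuously on a compact Hausdorff space $X$; it is minimal if every orbit $Gx$ is dense in $X$. A dynamical morphism is a continuous $G$-equivariant map; a factor map is a surjective one. For $d\ge 0$, $X^{[d]}$ is the set of maps $\{0,1\}^d\to X$ with the product topology, and for $x\in X$, $x^{[d]}\in X^{[d]}$ is the constant map with value $x$. For $h\in G$ and $F\subset\{0,1\}^d$, $[h]_F\in G^{[d]}=G^{\{0,1\}^d}$ is given by $[h]_F(\omega)=h$ if $\omega\in F$ and $[h]_F(\omega)=\mathrm{Id}$ otherwise. A hyperface of $\{0,1\}^d$ is a set $\{\omega:\omega_i=a\}$ with $1\le i\le d$, $a\in\{0,1\}$. The Host-Kra cube group $\mathcal{HK}^{[d]}$ is the subgroup of $G^{[d]}$ generated by all $[h]_F$ with $h\in G$ and $F$ a hyperface. It acts coordinatewise on $X^{[d]}$. Put $C_G^{[d]}(X)=\overline{\{g x^{[d]}: g\in\mathcal{HK}^{[d]},\ x\in X\}}\subset X^{[d]}$.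 For $x,y\in X$, $\llcorner^{[2]}(x,y)\in X^{[2]}$ is the configuration with value $y$ at $(1,1)$ and value $x$ at the other three vertices. Then $\mathbf{NRP}^{[1]}(X)=\{(x,y)\in X\times X:\ \llcorner^{[2]}(x,y)\in C_G^{[2]}(X)\}$. For minimal $(G,X)$ it is a closed $G$-invariant equivalence relation, so $(G,X/\mathbf{NRP}^{[1]}(X))$ is a t.d.s. Let $\mathrm{Aut}(G,X)$ be the group of bijective dynamical morphisms $(G,X)\to(G,X)$ with the uniform topology. $(G,X)$ is an abelian group t.d.s. if there exists a compact abelian group $K\subset\mathrm{Aut}(G,X)$ such that for all $x,y\in X$ there is a unique $k\in K$ with $kx=y$. (A minimal t.d.s. is an abelian group t.d.s. if and only if $X$ can be given the structure of a compact abelian group for which there is a continuous homomorphism $\varphi:G\to X$ with dense image such that $gx=\varphi(g)+x$.) *)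

theory Defs
  imports
    "HOL-Analysis.Analysis"
    "HOL-Algebra.Group_Action"
    "HOL-Algebra.Product_Groups"
begin

section \<open>Topological dynamical systems\<close>

locale topological_group = group G
  for G :: "('g, 'm) monoid_scheme" (structure) and T :: "'g topology" +
  assumes topspace_eq: "topspace T = carrier G"
    and continuous_mult: "continuous_map (prod_topology T T) T (\<lambda>(g, h). g \<otimes> h)"
    and continuous_inv: "continuous_map T T (\<lambda>g. inv g)"

text \<open>
  As \<^locale>\<open>group_action\<close> is a homomorphism into \<^const>\<open>BijGroup\<close>, each
  \<open>act g\<close> with \<open>g \<in> carrier G\<close> is an extensional function on \<open>topspace X\<close>.
\<close>

locale tds = topological_group G T + group_action G "topspace X" act
  for G :: "('g, 'm) monoid_scheme" (structure) and T :: "'g topology"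
    and X :: "'x topology" and act :: "'g \<Rightarrow> 'x \<Rightarrow> 'x" +
  assumes Hausdorff_group: "Hausdorff_space T"
    and compact_phase_space: "compact_space X"
    and Hausdorff_phase_space: "Hausdorff_space X"
    and continuous_action: "continuous_map (prod_topology T X) X (\<lambda>(g, x). act g x)"

locale minimal_tds = tds +
  assumes dense_orbit: "x \<in> topspace X \<Longrightarrow> X closure_of (orbit G act x) = topspace X"

definition dynamical_morphism ::
  "('g, 'm) monoid_scheme \<Rightarrow> 'x topology \<Rightarrow> ('g \<Rightarrow> 'x \<Rightarrow> 'x) \<Rightarrow>
    'y topology \<Rightarrow> ('g \<Rightarrow> 'y \<Rightarrow> 'y) \<Rightarrow> ('x \<Rightarrow> 'y) \<Rightarrow> bool" where
  "dynamical_morphism G X actX Y actY f \<longleftrightarrow>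
    continuous_map X Y f \<and>
    (\<forall>g \<in> carrier G. \<forall>x \<in> topspace X. f (actX g x) = actY g (f x))"

definition factor_map ::
  "('g, 'm) monoid_scheme \<Rightarrow> 'x topology \<Rightarrow> ('g \<Rightarrow> 'x \<Rightarrow> 'x) \<Rightarrow>
    'y topology \<Rightarrow> ('g \<Rightarrow> 'y \<Rightarrow> 'y) \<Rightarrow> ('x \<Rightarrow> 'y) \<Rightarrow> bool" where
  "factor_map G X actX Y actY f \<longleftrightarrow>
    dynamical_morphism G X actX Y actY f \<and> f ` topspace X = topspace Y"


section \<open>Automorphisms and abelian group systems\<close>

definition tds_auto ::
  "('g, 'm) monoid_scheme \<Rightarrow> 'x topology \<Rightarrow> ('g \<Rightarrow> 'x \<Rightarrow> 'x) \<Rightarrow> ('x \<Rightarrow> 'x) set" where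
  "tds_auto G X act = Bij (topspace X) \<inter> {f. dynamical_morphism G X act X act f}"

definition tds_AutoGroup ::
  "('g, 'm) monoid_scheme \<Rightarrow> 'x topology \<Rightarrow> ('g \<Rightarrow> 'x \<Rightarrow> 'x) \<Rightarrow> ('x \<Rightarrow> 'x) monoid" where
  "tds_AutoGroup G X act = BijGroup (topspace X) \<lparr>carrier := tds_auto G X act\<rparr>"

text \<open>
  The topology of uniform convergence on a set \<open>F\<close> of self-maps of a compact Hausdorff
  space \<open>X\<close>: the unique compatible uniformity of \<open>X\<close> consists of all neighbourhoods
  of the diagonal, so the open neighbourhoods \<open>W\<close> below form a base of entourages.
\<close>

definition uniform_topology :: "'x topology \<Rightarrow> ('x \<Rightarrow> 'x) set \<Rightarrow> ('x \<Rightarrow> 'x) topology" where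
  "uniform_topology X F = topology (\<lambda>U. U \<subseteq> F \<and>
    (\<forall>f \<in> U. \<exists>W. openin (prod_topology X X) W \<and> (\<forall>x \<in> topspace X. (x, x) \<in> W) \<and>
      {h \<in> F. \<forall>x \<in> topspace X. (f x, h x) \<in> W} \<subseteq> U))"

lemma openin_uniform_topology:
  "openin (uniform_topology X F) U \<longleftrightarrow> U \<subseteq> F \<and>
    (\<forall>f \<in> U. \<exists>W. openin (prod_topology X X) W \<and> (\<forall>x \<in> topspace X. (x, x) \<in> W) \<and>
      {h \<in> F. \<forall>x \<in> topspace X. (f x, h x) \<in> W} \<subseteq> U)"
proof -
  define near where "near f U \<longleftrightarrow>
    (\<exists>W. openin (prod_topology X X) W \<and> (\<forall>x \<in> topspace X. (x, x) \<in> W) \<and>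
      {h \<in> F. \<forall>x \<in> topspace X. (f x, h x) \<in> W} \<subseteq> U)" for f U
  have mono: "near f U'" if "near f U" "U \<subseteq> U'" for f U U'
    using that unfolding near_def by (meson subset_trans)
  have inter: "near f (U \<inter> U')" if "near f U" "near f U'" for f U U'
  proof -
    obtain V where V: "openin (prod_topology X X) V" "\<forall>x \<in> topspace X. (x, x) \<in> V"
      "{h \<in> F. \<forall>x \<in> topspace X. (f x, h x) \<in> V} \<subseteq> U"
      using \<open>near f U\<close> unfolding near_def by (elim exE conjE)
    obtain W where W: "openin (prod_topology X X) W" "\<forall>x \<in> topspace X. (x, x) \<in> W"
      "{h \<in> F. \<forall>x \<in> topspace X. (f x, h x) \<in> W} \<subseteq> U'"
      using \<open>near f U'\<close> unfolding near_def by (elim exE conjE)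
    have "openin (prod_topology X X) (V \<inter> W)"
      using V(1) W(1) by (rule openin_Int)
    moreover have "\<forall>x \<in> topspace X. (x, x) \<in> V \<inter> W"
      using V(2) W(2) by simp
    moreover have "{h \<in> F. \<forall>x \<in> topspace X. (f x, h x) \<in> V \<inter> W} \<subseteq> U \<inter> U'"
      using V(3) W(3) by (simp add: subset_iff)
    ultimately show ?thesis
      unfolding near_def by (intro exI conjI)
  qed
  have "istopology (\<lambda>U. U \<subseteq> F \<and> (\<forall>f \<in> U. near f U))"
    unfolding istopology_def
  proof (intro conjI allI impI)
    fix S T assume "S \<subseteq> F \<and> (\<forall>f \<in> S. near f S)" "T \<subseteq> F \<and> (\<forall>f \<in> T. near f T)"
    then show "S \<inter> T \<subseteq> F" "\<forall>f \<in> S \<inter> T. near f (S \<inter> T)"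
      by (blast intro: inter)+
  next
    fix \<K> assume "\<forall>K\<in>\<K>. K \<subseteq> F \<and> (\<forall>f \<in> K. near f K)"
    then show "\<Union>\<K> \<subseteq> F" "\<forall>f \<in> \<Union>\<K>. near f (\<Union>\<K>)"
      by (blast intro: mono)+
  qed
  then show ?thesis
    unfolding uniform_topology_def near_def by (simp only: topology_inverse')
qed

text \<open>
  With the uniform topology the automorphism group is a Hausdorff topological group, so
  the compact group structure of \<open>A\<close> amounts to compactness of \<open>A\<close> as a subset.
\<close>

definition abelian_group_tds ::
  "('g, 'm) monoid_scheme \<Rightarrow> 'g topology \<Rightarrow> 'x topology \<Rightarrow> ('g \<Rightarrow> 'x \<Rightarrow> 'x) \<Rightarrow> bool" where
  "abelian_group_tds G T X act \<longleftrightarrow> tds G T X act \<and>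
    (\<exists>A. subgroup A (tds_AutoGroup G X act) \<and>
      comm_group (tds_AutoGroup G X act \<lparr>carrier := A\<rparr>) \<and>
      compactin (uniform_topology X (tds_auto G X act)) A \<and>
      (\<forall>x \<in> topspace X. \<forall>y \<in> topspace X. \<exists>!k. k \<in> A \<and> k x = y))"


section \<open>Host--Kra cubes and the regionally proximal relation\<close>

definition cube :: "nat \<Rightarrow> (nat \<Rightarrow> nat) set" where
  "cube d = {1..d} \<rightarrow>\<^sub>E {0, 1}"

definition hyperface :: "nat \<Rightarrow> nat \<Rightarrow> nat \<Rightarrow> (nat \<Rightarrow> nat) set" where
  "hyperface d i a = {\<omega> \<in> cube d. \<omega> i = a}"

definition cube_topology :: "nat \<Rightarrow> 'x topology \<Rightarrow> ((nat \<Rightarrow> nat) \<Rightarrow> 'x) topology" where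
  "cube_topology d X = product_topology (\<lambda>_. X) (cube d)"

definition cube_group ::
  "nat \<Rightarrow> ('g, 'm) monoid_scheme \<Rightarrow> ((nat \<Rightarrow> nat) \<Rightarrow> 'g) monoid" where
  "cube_group d G = product_group (cube d) (\<lambda>_. G)"

definition cube_const :: "nat \<Rightarrow> 'x \<Rightarrow> (nat \<Rightarrow> nat) \<Rightarrow> 'x" where
  "cube_const d x = (\<lambda>\<omega> \<in> cube d. x)"

definition face_elem ::
  "('g, 'm) monoid_scheme \<Rightarrow> nat \<Rightarrow> 'g \<Rightarrow> (nat \<Rightarrow> nat) set \<Rightarrow> (nat \<Rightarrow> nat) \<Rightarrow> 'g" where
  "face_elem G d h F = (\<lambda>\<omega> \<in> cube d. if \<omega> \<in> F then h else \<one>\<^bsub>G\<^esub>)"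

definition HK :: "('g, 'm) monoid_scheme \<Rightarrow> nat \<Rightarrow> ((nat \<Rightarrow> nat) \<Rightarrow> 'g) set" where
  "HK G d = generate (cube_group d G)
    {face_elem G d h (hyperface d i a) | h i a. h \<in> carrier G \<and> i \<in> {1..d} \<and> a \<in> {0, 1}}"

definition cube_act ::
  "nat \<Rightarrow> ('g \<Rightarrow> 'x \<Rightarrow> 'x) \<Rightarrow> ((nat \<Rightarrow> nat) \<Rightarrow> 'g) \<Rightarrow> ((nat \<Rightarrow> nat) \<Rightarrow> 'x) \<Rightarrow> (nat \<Rightarrow> nat) \<Rightarrow> 'x" where
  "cube_act d act g c = (\<lambda>\<omega> \<in> cube d. act (g \<omega>) (c \<omega>))"

definition dynamical_cubes ::
  "('g, 'm) monoid_scheme \<Rightarrow> 'x topology \<Rightarrow> ('g \<Rightarrow> 'x \<Rightarrow> 'x) \<Rightarrow> nat \<Rightarrow>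
    ((nat \<Rightarrow> nat) \<Rightarrow> 'x) set" where
  "dynamical_cubes G X act d = cube_topology d X closure_of
    {cube_act d act g (cube_const d x) | g x. g \<in> HK G d \<and> x \<in> topspace X}"

definition lower_corner :: "'x \<Rightarrow> 'x \<Rightarrow> (nat \<Rightarrow> nat) \<Rightarrow> 'x" where
  "lower_corner x y = (\<lambda>\<omega> \<in> cube 2. if \<omega> 1 = 1 \<and> \<omega> 2 = 1 then y else x)"

definition NRP1 ::
  "('g, 'm) monoid_scheme \<Rightarrow> 'x topology \<Rightarrow> ('g \<Rightarrow> 'x \<Rightarrow> 'x) \<Rightarrow> ('x \<times> 'x) set" where
  "NRP1 G X act = {(x, y) \<in> topspace X \<times> topspace X.
    lower_corner x y \<in> dynamical_cubes G X act 2}"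


section \<open>Quotient systems\<close>

text \<open>
  Meant for a \<open>G\<close>-invariant equivalence relation \<open>R\<close> on \<open>topspace X\<close>: points of the
  quotient are the classes \<open>R `` {x}\<close>, and \<open>g\<close> maps the class of \<open>x\<close> to its image,
  which by invariance is the class of \<open>act g x\<close>.
\<close>

definition quotient_topology :: "'x topology \<Rightarrow> ('x \<times> 'x) set \<Rightarrow> 'x set topology" where
  "quotient_topology X R = topology (\<lambda>U. U \<subseteq> topspace X // R \<and>
    openin X {x \<in> topspace X. R `` {x} \<in> U})"

lemma openin_quotient_topology:
  "openin (quotient_topology X R) U \<longleftrightarrow>
    U \<subseteq> topspace X // R \<and> openin X {x \<in> topspace X. R `` {x} \<in> U}"
proof -
  have "istopology (\<lambda>U. U \<subseteq> topspace X // R \<and> openin X {x \<in> topspace X. R `` {x} \<in> U})"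
    (is "istopology ?L")
    unfolding istopology_def
  proof (intro conjI allI impI)
    fix S T assume S: "?L S" and T: "?L T"
    show "S \<inter> T \<subseteq> topspace X // R" using S by blast
    have "{x \<in> topspace X. R `` {x} \<in> S \<inter> T} =
      {x \<in> topspace X. R `` {x} \<in> S} \<inter> {x \<in> topspace X. R `` {x} \<in> T}" by blast
    then show "openin X {x \<in> topspace X. R `` {x} \<in> S \<inter> T}"
      using S T by (simp add: openin_Int)
  next
    fix \<K> assume K: "\<forall>K\<in>\<K>. ?L K"
    show "\<Union>\<K> \<subseteq> topspace X // R" using K by blast
    have "{x \<in> topspace X. R `` {x} \<in> \<Union>\<K>} =
      (\<Union>K\<in>\<K>. {x \<in> topspace X. R `` {x} \<in> K})" by blast
    then show "openin X {x \<in> topspace X. R `` {x} \<in> \<Union>\<K>}"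
      using K by (simp add: openin_clauses(3) openin_Union)
  qed
  then show ?thesis
    by (simp add: quotient_topology_def)
qed

lemma quotient_map_quotient_topology:
  "quotient_map X (quotient_topology X R) (\<lambda>x. R `` {x})"
proof -
  have "{x \<in> topspace X. R `` {x} \<in> topspace X // R} = topspace X"
    by (auto intro: quotientI)
  then have "openin (quotient_topology X R) (topspace X // R)"
    by (simp add: openin_quotient_topology)
  then have "topspace (quotient_topology X R) = topspace X // R"
    by (metis openin_quotient_topology openin_subset openin_topspace subset_antisym)
  then show ?thesis
    by (auto simp: quotient_map_def openin_quotient_topology quotient_def)
qed

definition quotient_act ::
  "'x topology \<Rightarrow> ('x \<times> 'x) set \<Rightarrow> ('g \<Rightarrow> 'x \<Rightarrow> 'x) \<Rightarrow> 'g \<Rightarrow> 'x set \<Rightarrow> 'x set" where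
  "quotient_act X R act g = (\<lambda>C \<in> topspace X // R. act g ` C)"

end

theory Submission
  imports Defs
begin

text \<open>
  Let \<open>E\<close> be the enveloping semigroup of \<open>X\<close>, \<open>u\<close> a minimal idempotent of \<open>E\<close> fixing \<open>x0\<close>,
  and \<open>\<Gamma> = u E u\<close>, a group. Inside \<open>E \<times> E \<times> E\<close> let \<open>S\<close> be the closed semigroup generated by
  \<open>(h, 1, h)\<close> and \<open>(1, k, k)\<close>: it describes the action of the Host--Kra group on the three vertices
  of a square other than a fixed one. Ellis' idempotent lemma shows that \<open>S \<inter> \<Gamma>\<^sup>3\<close> is a group.
  The third coordinates of its elements whose first two coordinates fix \<open>x0\<close> form a subgroup \<open>L\<close>
  of \<open>\<Gamma>\<close> containing all commutators, since \<open>(a, b, a b)\<close> and \<open>(a, b, b a)\<close> both lie in \<open>S\<close>.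
  Sending \<open>p x0\<close> to the class of \<open>p\<close> defines an equivariant map \<open>\<beta>\<close> from \<open>X\<close> onto the abelian
  group \<open>\<Gamma> / L\<close>.

  The compact set \<open>W = S (x0, x0, x0)\<close> lies in the graph of addition seen through \<open>\<beta>\<close>, and every
  pair \<open>(x, y)\<close> extends to a triple of \<open>W\<close>. Projecting compact pieces of \<open>W\<close> shows that the fibres of
  \<open>\<beta>\<close> form a closed relation and that addition is continuous on the quotient, which is therefore a
  compact abelian group. If \<open>\<beta> x = \<beta> y\<close>, an explicit element of \<open>S\<close> moves \<open>(x, x, x)\<close> to
  \<open>(y, y, y)\<close>, so \<open>(y, x)\<close> is in \<open>NRP\<^sup>[\<^sup>1\<^sup>]\<close>. Conversely every abelian group factor \<open>K\<close> identifies the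
  pairs of \<open>NRP\<^sup>[\<^sup>1\<^sup>]\<close>, because the squares \<open>(k, a k, b k, a b k)\<close> form a closed subset of \<open>K\<^sup>4\<close>.
\<close>

section \<open>Minimal members of families of closed sets\<close>

text \<open>Zorn's lemma is applied to complements. A finite part of a chain has a smallest member,
  so a chain of nonempty closed sets has the finite intersection property, and compactness keeps its
  intersection nonempty.\<close>

lemma compact_space_minimal_closedin:
  assumes "compact_space Z" and "\<F> \<noteq> {}"
    and closed: "\<And>F. F \<in> \<F> \<Longrightarrow> closedin Z F \<and> F \<noteq> {}"
    and inter: "\<And>\<C>. \<C> \<noteq> {} \<Longrightarrow> \<C> \<subseteq> \<F> \<Longrightarrow> \<Inter>\<C> \<noteq> {} \<Longrightarrow> \<Inter>\<C> \<in> \<F>"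
  shows "\<exists>M\<in>\<F>. \<forall>F\<in>\<F>. F \<subseteq> M \<longrightarrow> F = M"
proof -
  have "\<exists>N\<in>uminus ` \<F>. \<forall>K\<in>uminus ` \<F>. N \<subseteq> K \<longrightarrow> K = N"
  proof (rule subset_Zorn)
    fix \<C> assume chain: "subset.chain (uminus ` \<F>) \<C>"
    show "\<exists>U\<in>uminus ` \<F>. \<forall>K\<in>\<C>. K \<subseteq> U"
    proof (cases "\<C> = {}")
      case True
      then show ?thesis using \<open>\<F> \<noteq> {}\<close> by auto
    next
      case False
      define \<D> where "\<D> = uminus ` \<C>"
      have \<D>: "\<D> \<noteq> {}" "\<D> \<subseteq> \<F>"
        using False chain by (auto simp: \<D>_def subset.chain_def)
      have lin: "A \<subseteq> B \<or> B \<subseteq> A" if AB: "A \<in> \<D>" "B \<in> \<D>" for A B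
      proof -
        obtain A' B' where "A' \<in> \<C>" "B' \<in> \<C>" "A = - A'" "B = - B'"
          using AB by (auto simp: \<D>_def)
        moreover from this have "A' \<subseteq> B' \<or> B' \<subseteq> A'"
          using chain unfolding subset.chain_def by blast
        ultimately show ?thesis by auto
      qed
      have least: "\<exists>A\<in>\<K>. \<Inter>\<K> = A" if "finite \<K>" "\<K> \<noteq> {}" "\<K> \<subseteq> \<D>" for \<K>
        using that
      proof (induction \<K> rule: finite_ne_induct)
        case (insert A \<K>)
        then obtain B where "B \<in> \<K>" "\<Inter>\<K> = B" by blast
        moreover from this have "A \<inter> B = A \<or> A \<inter> B = B"
          using lin[of A B] insert.prems by blast
        ultimately show ?case by auto
      qed auto
      have "\<Inter>\<D> \<noteq> {}"
      proof (rule \<open>compact_space Z\<close>[unfolded compact_space_fip, rule_format])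
        show "(\<forall>C\<in>\<D>. closedin Z C) \<and> (\<forall>\<K>. finite \<K> \<and> \<K> \<subseteq> \<D> \<longrightarrow> \<Inter>\<K> \<noteq> {})"
          using \<D> closed least by (metis Inter_empty UNIV_not_empty subsetD)
      qed
      then have "\<Inter>\<D> \<in> \<F>"
        using inter \<D> by blast
      moreover have "K \<subseteq> - \<Inter>\<D>" if "K \<in> \<C>" for K
        using that by (auto simp: \<D>_def)
      ultimately show ?thesis by blast
    qed
  qed
  then show ?thesis
    by (auto simp: image_iff)
qed


section \<open>Compact right topological semigroups\<close>

text \<open>Ellis' setting: continuity is asked for in the left factor alone, because composition of
  arbitrary self-maps under pointwise convergence has in general only this one-sided
  continuity.\<close>

locale compact_right_semigroup =
  fixes Z :: "'a topology" and mul :: "'a \<Rightarrow> 'a \<Rightarrow> 'a" (infixl \<open>\<odot>\<close> 70)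
  assumes compact: "compact_space Z" and Hausdorff: "Hausdorff_space Z"
    and mul_closed: "a \<in> topspace Z \<Longrightarrow> b \<in> topspace Z \<Longrightarrow> a \<odot> b \<in> topspace Z"
    and mul_assoc: "a \<in> topspace Z \<Longrightarrow> b \<in> topspace Z \<Longrightarrow> c \<in> topspace Z \<Longrightarrow>
      (a \<odot> b) \<odot> c = a \<odot> (b \<odot> c)"
    and right_continuous: "b \<in> topspace Z \<Longrightarrow> continuous_map Z Z (\<lambda>a. a \<odot> b)"
begin

definition closed_subsemigroup :: "'a set \<Rightarrow> bool" where
  "closed_subsemigroup S \<longleftrightarrow> closedin Z S \<and> (\<forall>a\<in>S. \<forall>b\<in>S. a \<odot> b \<in> S)"

definition semigroup_closure :: "'a set \<Rightarrow> 'a set" where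
  "semigroup_closure K = \<Inter>{S. closed_subsemigroup S \<and> K \<subseteq> S}"

lemma closed_subsemigroup_topspace: "closed_subsemigroup (topspace Z)"
  by (simp add: closed_subsemigroup_def mul_closed)

lemma closed_subsemigroup_Inter:
  assumes "\<S> \<noteq> {}" "\<And>S. S \<in> \<S> \<Longrightarrow> closed_subsemigroup S"
  shows "closed_subsemigroup (\<Inter>\<S>)"
  using assms unfolding closed_subsemigroup_def by (auto intro: closedin_Inter)

lemma closed_subsemigroup_closure:
  assumes "K \<subseteq> topspace Z"
  shows "closed_subsemigroup (semigroup_closure K)"
  unfolding semigroup_closure_def
  using assms closed_subsemigroup_topspace by (intro closed_subsemigroup_Inter) auto

lemma semigroup_closure_subset: "K \<subseteq> semigroup_closure K"
  by (auto simp: semigroup_closure_def)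

lemma semigroup_closure_minimal:
  "closed_subsemigroup S \<Longrightarrow> K \<subseteq> S \<Longrightarrow> semigroup_closure K \<subseteq> S"
  by (auto simp: semigroup_closure_def)

lemma subsemigroup_in_topspace:
  "closed_subsemigroup S \<Longrightarrow> a \<in> S \<Longrightarrow> a \<in> topspace Z"
  by (meson closed_subsemigroup_def closedin_subset subsetD)

lemma closedin_right_translate:
  assumes "closedin Z S" "b \<in> topspace Z"
  shows "closedin Z ((\<lambda>a. a \<odot> b) ` S)"
proof -
  have "compactin Z S"
    using assms compact by (simp add: closedin_compact_space)
  then show ?thesis
    using image_compactin right_continuous[OF assms(2)] compactin_imp_closedin[OF Hausdorff]
    by blast
qed

lemma closed_subsemigroup_translate:
  assumes S: "closed_subsemigroup S" and "b \<in> S"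
  shows "closed_subsemigroup ((\<lambda>a. a \<odot> b) ` S)"
proof -
  have "\<exists>c\<in>S. a \<odot> b \<odot> (a' \<odot> b) = c \<odot> b" if "a \<in> S" "a' \<in> S" for a a'
  proof (intro bexI)
    show "a \<odot> b \<odot> a' \<in> S"
      using that S \<open>b \<in> S\<close> by (simp add: closed_subsemigroup_def)
    show "a \<odot> b \<odot> (a' \<odot> b) = a \<odot> b \<odot> a' \<odot> b"
      using that S \<open>b \<in> S\<close> by (metis mul_assoc mul_closed subsemigroup_in_topspace)
  qed
  then show ?thesis
    using S \<open>b \<in> S\<close> closedin_right_translate subsemigroup_in_topspace[OF S]
    by (force simp: closed_subsemigroup_def)
qed

text \<open>Ellis-Numakura argument. If \<open>M\<close> is a minimal closed subsemigroup and
  \<open>e \<in> M\<close>, the translate of \<open>M\<close> by \<open>e\<close> is a closed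
  subsemigroup of \<open>M\<close>, hence all of \<open>M\<close>; so \<open>f \<odot> e = e\<close>
  for some \<open>f \<in> M\<close>. The solutions \<open>f\<close> form a closed subsemigroup,
  again all of \<open>M\<close>, and therefore \<open>e\<close> is a solution.\<close>

lemma idempotent_exists:
  assumes "closed_subsemigroup S" "S \<noteq> {}"
  shows "\<exists>e\<in>S. e \<odot> e = e"
proof -
  let ?\<F> = "{F. closed_subsemigroup F \<and> F \<noteq> {} \<and> F \<subseteq> S}"
  have "\<exists>M\<in>?\<F>. \<forall>F\<in>?\<F>. F \<subseteq> M \<longrightarrow> F = M"
  proof (rule compact_space_minimal_closedin[OF compact])
    show "?\<F> \<noteq> {}" using assms by blast
    show "\<Inter>\<C> \<in> ?\<F>" if "\<C> \<noteq> {}" "\<C> \<subseteq> ?\<F>" "\<Inter>\<C> \<noteq> {}" for \<C>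
    proof -
      have "closed_subsemigroup (\<Inter>\<C>)"
        using that by (intro closed_subsemigroup_Inter) auto
      then show ?thesis using that by blast
    qed
  qed (auto simp: closed_subsemigroup_def)
  then obtain M where "M \<in> ?\<F>" and least: "\<forall>F\<in>?\<F>. F \<subseteq> M \<longrightarrow> F = M" ..
  then have M: "closed_subsemigroup M" "M \<noteq> {}" "M \<subseteq> S"
    by auto
  have min: "F = M" if "closed_subsemigroup F" "F \<noteq> {}" "F \<subseteq> M" for F
    using least[rule_format, of F] that \<open>M \<subseteq> S\<close> by blast
  obtain e where e: "e \<in> M" using M(2) by blast
  have inZ: "a \<in> topspace Z" if "a \<in> M" for a
    using subsemigroup_in_topspace[OF M(1) that] .
  have "(\<lambda>a. a \<odot> e) ` M = M"
    using closed_subsemigroup_translate[OF M(1) e] M e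
    by (intro min) (auto simp: closed_subsemigroup_def)
  then obtain f where f: "f \<in> M" "f \<odot> e = e"
    using e by (metis (no_types, lifting) imageE)
  define F where "F = {a \<in> M. a \<odot> e = e}"
  have "F = M \<inter> {a \<in> topspace Z. a \<odot> e \<in> {e}}"
    using inZ by (auto simp: F_def)
  moreover have "closedin Z {e}"
    using Hausdorff inZ[OF e] by (simp add: closedin_Hausdorff_singleton)
  ultimately have "closedin Z F"
    using M(1) closedin_continuous_map_preimage[OF right_continuous[OF inZ[OF e]], of "{e}"]
    by (simp add: closed_subsemigroup_def closedin_Int)
  moreover have "a \<odot> b \<in> F" if "a \<in> F" "b \<in> F" for a b
    using that M(1) inZ e mul_assoc[of a b e] by (auto simp: F_def closed_subsemigroup_def)
  ultimately have "F = M"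
    using f by (intro min) (auto simp: F_def closed_subsemigroup_def)
  then show ?thesis using e M(3) by (auto simp: F_def)
qed

text \<open>For idempotent \<open>u\<close> the last property says that the left ideal \<open>S \<odot> u\<close> is minimal.\<close>

definition minimal_idempotent :: "'a set \<Rightarrow> 'a \<Rightarrow> bool" where
  "minimal_idempotent S u \<longleftrightarrow> u \<in> S \<and> u \<odot> u = u \<and> (\<forall>m\<in>S. \<exists>e\<in>S. e \<odot> (m \<odot> u) = u)"

text \<open>A minimal closed left ideal \<open>M\<close> of \<open>S\<close> is a closed
  subsemigroup and contains an idempotent \<open>u\<close>. For \<open>m \<in> S\<close> the
  translate of \<open>S\<close> by \<open>m \<odot> u\<close> is a closed left ideal inside
  \<open>M\<close>, so it equals \<open>M\<close> and contains \<open>u\<close>.\<close>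

lemma minimal_idempotent_exists:
  assumes S: "closed_subsemigroup S" "S \<noteq> {}"
  shows "\<exists>u. minimal_idempotent S u"
proof -
  have inZ: "a \<in> topspace Z" if "a \<in> S" for a
    using subsemigroup_in_topspace[OF S(1) that] .
  let ?\<F> = "{F. closedin Z F \<and> F \<noteq> {} \<and> F \<subseteq> S \<and> (\<forall>a\<in>S. \<forall>b\<in>F. a \<odot> b \<in> F)}"
  have "\<exists>M\<in>?\<F>. \<forall>F\<in>?\<F>. F \<subseteq> M \<longrightarrow> F = M"
  proof (rule compact_space_minimal_closedin[OF compact])
    show "?\<F> \<noteq> {}" using S by (auto simp: closed_subsemigroup_def)
    show "\<Inter>\<C> \<in> ?\<F>" if "\<C> \<noteq> {}" "\<C> \<subseteq> ?\<F>" "\<Inter>\<C> \<noteq> {}" for \<C>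
    proof -
      have "closedin Z (\<Inter>\<C>)"
        using that by (intro closedin_Inter) auto
      then show ?thesis using that by blast
    qed
  qed auto
  then obtain M where "M \<in> ?\<F>" and least: "\<forall>F\<in>?\<F>. F \<subseteq> M \<longrightarrow> F = M" ..
  then have M: "closedin Z M" "M \<noteq> {}" "M \<subseteq> S" "\<And>a b. a \<in> S \<Longrightarrow> b \<in> M \<Longrightarrow> a \<odot> b \<in> M"
    by auto
  have min: "F = M" if "closedin Z F" "F \<noteq> {}" "F \<subseteq> M" "\<And>a b. a \<in> S \<Longrightarrow> b \<in> F \<Longrightarrow> a \<odot> b \<in> F" for F
    using least[rule_format, of F] that \<open>M \<subseteq> S\<close> by blast
  obtain u where u: "u \<in> M" "u \<odot> u = u"
    using idempotent_exists[of M] M by (auto simp: closed_subsemigroup_def subset_iff)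
  have "\<exists>e\<in>S. e \<odot> (m \<odot> u) = u" if m: "m \<in> S" for m
  proof -
    have mu: "m \<odot> u \<in> M" using M(4) m u(1) by blast
    have "(\<lambda>a. a \<odot> (m \<odot> u)) ` S = M"
    proof (rule min)
      show "closedin Z ((\<lambda>a. a \<odot> (m \<odot> u)) ` S)"
        using S(1) M(3) mu inZ by (intro closedin_right_translate) (auto simp: closed_subsemigroup_def)
      show "(\<lambda>a. a \<odot> (m \<odot> u)) ` S \<noteq> {}" using S by blast
      show "(\<lambda>a. a \<odot> (m \<odot> u)) ` S \<subseteq> M" using M(4) mu by blast
      fix a b assume a: "a \<in> S" and "b \<in> (\<lambda>a. a \<odot> (m \<odot> u)) ` S"
      then obtain c where c: "c \<in> S" "b = c \<odot> (m \<odot> u)" by blast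
      have "a \<odot> b = (a \<odot> c) \<odot> (m \<odot> u)"
        using c(2) mul_assoc[OF inZ[OF a] inZ[OF c(1)], of "m \<odot> u"] mu M(3) inZ by auto
      then show "a \<odot> b \<in> (\<lambda>a. a \<odot> (m \<odot> u)) ` S"
        using a c(1) S(1) by (auto simp: closed_subsemigroup_def)
    qed
    then show ?thesis using u(1) by (metis (no_types, lifting) imageE)
  qed
  then show ?thesis
    using u M(3) by (auto simp: minimal_idempotent_def)
qed

end

lemma compact_right_semigroup_prod:
  assumes "compact_right_semigroup Z f" "compact_right_semigroup Y g"
  shows "compact_right_semigroup (prod_topology Z Y) (\<lambda>(a, b) (c, d). (f a c, g b d))"
proof -
  interpret Z: compact_right_semigroup Z f by fact
  interpret Y: compact_right_semigroup Y g by fact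
  show ?thesis
  proof
    show "compact_space (prod_topology Z Y)"
      by (simp add: compact_space_prod_topology Z.compact Y.compact)
    show "Hausdorff_space (prod_topology Z Y)"
      by (simp add: Hausdorff_space_prod_topology Z.Hausdorff Y.Hausdorff)
    fix p assume "p \<in> topspace (prod_topology Z Y)"
    then obtain c d where p: "p = (c, d)" "c \<in> topspace Z" "d \<in> topspace Y" by auto
    have "continuous_map (prod_topology Z Y) (prod_topology Z Y) (\<lambda>q. (f (fst q) c, g (snd q) d))"
      using p continuous_map_compose[OF continuous_map_fst Z.right_continuous, unfolded o_def]
        continuous_map_compose[OF continuous_map_snd Y.right_continuous, unfolded o_def]
      by (intro continuous_map_pairedI) auto
    then show "continuous_map (prod_topology Z Y) (prod_topology Z Y)
        (\<lambda>a. (case a of (a, b) \<Rightarrow> \<lambda>(c, d). (f a c, g b d)) p)"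
      by (simp add: p(1) case_prod_unfold)
  qed (auto simp: Z.mul_closed Y.mul_closed Z.mul_assoc Y.mul_assoc)
qed

lemma compact_right_semigroup_compose:
  assumes "compact_space X" "Hausdorff_space X"
  shows "compact_right_semigroup (product_topology (\<lambda>_. X) (topspace X)) (compose (topspace X))"
proof
  let ?Z = "product_topology (\<lambda>_. X) (topspace X)"
  show "compact_space ?Z" "Hausdorff_space ?Z"
    using assms by (simp_all add: compact_space_product_topology Hausdorff_space_product_topology)
  show "compose (topspace X) a b \<in> topspace ?Z" if "a \<in> topspace ?Z" "b \<in> topspace ?Z" for a b
    using that by (auto simp: compose_def PiE_iff)
  show "compose (topspace X) (compose (topspace X) a b) c = compose (topspace X) a (compose (topspace X) b c)"
    if "c \<in> topspace ?Z" for a b c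
    using that by (auto simp: compose_def PiE_iff fun_eq_iff)
  \<comment> \<open>At \<open>x\<close>, the product of \<open>a\<close> and \<open>b\<close> is the
    coordinate of \<open>a\<close> at the fixed point \<open>b x\<close>, and coordinates are
    continuous.\<close>
  show "continuous_map ?Z ?Z (\<lambda>a. compose (topspace X) a b)" if "b \<in> topspace ?Z" for b
    using that by (auto simp: continuous_map_componentwise compose_def PiE_iff
        intro!: continuous_map_product_projection)
qed


section \<open>Quotient systems\<close>

lemma group_actionI:
  fixes G (structure)
  assumes "group G"
    and extensional: "\<And>g. g \<in> carrier G \<Longrightarrow> \<phi> g \<in> extensional E"
    and closed: "\<And>g x. g \<in> carrier G \<Longrightarrow> x \<in> E \<Longrightarrow> \<phi> g x \<in> E"
    and one: "\<And>x. x \<in> E \<Longrightarrow> \<phi> \<one> x = x"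
    and mult: "\<And>g h x. g \<in> carrier G \<Longrightarrow> h \<in> carrier G \<Longrightarrow> x \<in> E \<Longrightarrow> \<phi> (g \<otimes> h) x = \<phi> g (\<phi> h x)"
  shows "group_action G E \<phi>"
proof -
  interpret group G by fact
  have Bij: "\<phi> g \<in> Bij E" if g: "g \<in> carrier G" for g
  proof -
    have "bij_betw (\<phi> g) E E"
      using g closed one mult[of "inv g" g] mult[of g "inv g"]
      by (intro bij_betw_byWitness[where f' = "\<phi> (inv g)"]) auto
    then show ?thesis using extensional g by (simp add: Bij_def)
  qed
  have "\<phi> \<in> hom G (BijGroup E)"
  proof (rule homI)
    show "\<phi> g \<in> carrier (BijGroup E)" if "g \<in> carrier G" for g
      using Bij that by (simp add: BijGroup_def)
    fix g h assume gh: "g \<in> carrier G" "h \<in> carrier G"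
    have "\<phi> (g \<otimes> h) = compose E (\<phi> g) (\<phi> h)"
      using gh by (intro extensionalityI[of _ E]) (auto simp: extensional mult compose_def)
    then show "\<phi> (g \<otimes> h) = \<phi> g \<otimes>\<^bsub>BijGroup E\<^esub> \<phi> h"
      using Bij gh by (simp add: BijGroup_def)
  qed
  then show ?thesis
    using group_axioms group_BijGroup
    by (auto simp: group_action_def group_hom_def group_hom_axioms_def)
qed

context tds
begin

lemma act_closed: "g \<in> carrier G \<Longrightarrow> x \<in> topspace X \<Longrightarrow> act g x \<in> topspace X"
  using element_image by blast

lemma act_mult: "g \<in> carrier G \<Longrightarrow> h \<in> carrier G \<Longrightarrow> x \<in> topspace X \<Longrightarrow> act (g \<otimes> h) x = act g (act h x)"
  using composition_rule by blast

lemma act_one: "x \<in> topspace X \<Longrightarrow> act \<one> x = x"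
  using id_eq_one by (metis restrict_apply')

lemma act_extensional: "g \<in> carrier G \<Longrightarrow> act g \<in> extensional (topspace X)"
  using bij_prop0 by (simp add: Bij_def)

lemma continuous_act:
  assumes "g \<in> carrier G"
  shows "continuous_map X X (act g)"
proof -
  have "continuous_map X (prod_topology T X) (\<lambda>x. (g, x))"
    using assms by (simp add: continuous_map_pairedI topspace_eq)
  from continuous_map_compose[OF this continuous_action] show ?thesis
    by (simp add: o_def)
qed

lemma act_inv:
  assumes "g \<in> carrier G" "x \<in> topspace X"
  shows "act (inv g) (act g x) = x" "act g (act (inv g) x) = x"
  using assms by (simp_all flip: act_mult add: act_one)

end

section \<open>Quotients by closed invariant equivalence relations\<close>

lemma topspace_quotient_topology: "topspace (quotient_topology X R) = topspace X // R"
  using quotient_imp_surjective_map[OF quotient_map_quotient_topology[of X R]]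
  by (auto simp: quotient_def)

locale tds_congruence = tds +
  fixes R
  assumes equiv: "equiv (topspace X) R"
    and closed: "closedin (prod_topology X X) R"
    and invariant: "g \<in> carrier G \<Longrightarrow> (x, y) \<in> R \<Longrightarrow> (act g x, act g y) \<in> R"
begin

abbreviation "Q \<equiv> quotient_topology X R"

lemma class_closed: "x \<in> topspace X \<Longrightarrow> R `` {x} \<in> topspace Q"
  by (simp add: topspace_quotient_topology quotientI)

lemma class_cases:
  assumes "C \<in> topspace Q" obtains x where "x \<in> topspace X" "C = R `` {x}"
  using assms by (auto simp: topspace_quotient_topology quotient_def)

lemma class_eq: "x \<in> topspace X \<Longrightarrow> y \<in> topspace X \<Longrightarrow> R `` {x} = R `` {y} \<longleftrightarrow> (x, y) \<in> R"
  using equiv by (simp add: eq_equiv_class_iff)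

lemma relD: "(x, y) \<in> R \<Longrightarrow> x \<in> topspace X \<and> y \<in> topspace X"
  using closedin_subset[OF closed] by auto

lemma continuous_class: "continuous_map X Q (\<lambda>x. R `` {x})"
  by (simp add: quotient_imp_continuous_map quotient_map_quotient_topology)

lemma quotient_act_class:
  assumes g: "g \<in> carrier G" and x: "x \<in> topspace X"
  shows "quotient_act X R act g (R `` {x}) = R `` {act g x}"
proof -
  have "act g ` (R `` {x}) = R `` {act g x}"
  proof
    show "act g ` (R `` {x}) \<subseteq> R `` {act g x}"
      using g by (auto intro: invariant)
    show "R `` {act g x} \<subseteq> act g ` (R `` {x})"
    proof
      fix y assume y: "y \<in> R `` {act g x}"
      then have "(act (inv g) (act g x), act (inv g) y) \<in> R"
        using g by (auto intro: invariant)
      moreover have "y \<in> topspace X" using y relD by auto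
      ultimately show "y \<in> act g ` (R `` {x})"
        using g x by (auto simp: act_inv intro!: image_eqI[where x = "act (inv g) y"])
    qed
  qed
  then show ?thesis
    using class_closed[OF x] by (simp add: quotient_act_def topspace_quotient_topology)
qed

text \<open>The saturation of a closed set \<open>F\<close> is the projection of the closed set
  \<open>R \<inter> F \<times> topspace X\<close> along a compact factor, hence closed.\<close>

lemma closed_map_class: "closed_map X Q (\<lambda>x. R `` {x})"
  unfolding closed_map_def
proof (intro allI impI)
  fix F assume F: "closedin X F"
  then have FX: "F \<subseteq> topspace X" by (simp add: closedin_subset)
  have "{x \<in> topspace X. R `` {x} \<in> (\<lambda>x. R `` {x}) ` F} = snd ` (R \<inter> F \<times> topspace X)"
  proof -
    have *: "R `` {x} \<in> (\<lambda>x. R `` {x}) ` F \<longleftrightarrow> (\<exists>y\<in>F. (y, x) \<in> R)" if "x \<in> topspace X" for x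
      unfolding image_iff using that FX class_eq[of _ x] by (intro bex_cong refl) (auto simp: eq_commute)
    have "{x \<in> topspace X. R `` {x} \<in> (\<lambda>x. R `` {x}) ` F} = {x \<in> topspace X. \<exists>y\<in>F. (y, x) \<in> R}"
      by (rule Collect_cong) (use * in blast)
    also have "\<dots> = snd ` (R \<inter> F \<times> topspace X)"
      by force
    finally show ?thesis .
  qed
  moreover have "closedin X (snd ` (R \<inter> F \<times> topspace X))"
  proof -
    have "closedin (prod_topology X X) (R \<inter> F \<times> topspace X)"
      using closed F by (intro closedin_Int) (auto simp: closedin_prod_Times_iff)
    then show ?thesis
      using closed_map_snd[OF compact_phase_space, of X] by (simp add: closed_map_def)
  qed
  moreover have "(\<lambda>x. R `` {x}) ` F \<subseteq> topspace Q"
    using FX class_closed by auto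
  ultimately show "closedin Q ((\<lambda>x. R `` {x}) ` F)"
    using conjunct2[OF quotient_map_quotient_topology[of X R, unfolded quotient_map_closedin],
        rule_format, of "(\<lambda>x. R `` {x}) ` F"] by simp
qed

lemma compact_quotient: "compact_space Q"
  using image_compactin[OF _ continuous_class] compact_phase_space
  by (metis compact_space_def quotient_imp_surjective_map quotient_map_quotient_topology)

text \<open>Normality passes to closed continuous images, and classes are closed points as images of
  points.\<close>

lemma Hausdorff_quotient: "Hausdorff_space Q"
proof (rule normal_t1_imp_Hausdorff_space)
  show "normal_space Q"
    using closed_map_class continuous_class compact_phase_space Hausdorff_phase_space
      quotient_imp_surjective_map[OF quotient_map_quotient_topology]
    by (intro normal_space_continuous_closed_map_image[of X Q "\<lambda>x. R `` {x}"]
        compact_Hausdorff_or_regular_imp_normal_space) auto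
  show "t1_space Q"
    unfolding t1_space_closedin_singleton
  proof
    fix C assume "C \<in> topspace Q"
    then obtain x where x: "x \<in> topspace X" "C = R `` {x}" by (rule class_cases)
    then have "closedin X {x}"
      using Hausdorff_phase_space by (simp add: closedin_Hausdorff_singleton)
    then have "closedin Q ((\<lambda>x. R `` {x}) ` {x})"
      using closed_map_class unfolding closed_map_def by blast
    then show "closedin Q {C}" using x by simp
  qed
qed

text \<open>Joint continuity of the action is the delicate point, since multiplying a quotient map
  by the identity of \<open>T\<close> need not give a quotient map. Here the projection goes from a
  compact to a Hausdorff space, so it is proper; its product with the identity is then proper, hence
  closed, hence a quotient map.\<close>

lemma tds_quotient: "tds G T Q (quotient_act X R act)"
proof -
  let ?\<pi> = "\<lambda>x. R `` {x}" and ?act = "quotient_act X R act"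
  have action: "group_action G (topspace Q) ?act"
  proof (rule group_actionI)
    show "?act g \<in> extensional (topspace Q)" for g
      by (simp add: quotient_act_def topspace_quotient_topology)
  qed (auto elim!: class_cases
      simp: quotient_act_class class_closed act_closed act_one act_mult group_axioms)
  have prod: "quotient_map (prod_topology T X) (prod_topology T Q) (\<lambda>(g, x). (g, ?\<pi> x))"
  proof (rule continuous_closed_imp_quotient_map)
    have "proper_map X Q ?\<pi>"
      using compact_phase_space Hausdorff_quotient continuous_class
      by (intro continuous_imp_proper_map) (auto simp: Hausdorff_imp_kc_space)
    then have "proper_map (prod_topology T X) (prod_topology T Q) (\<lambda>(g, x). (g, ?\<pi> x))"
      using proper_map_prod[of T X T Q "\<lambda>g. g" ?\<pi>] proper_map_id by (auto simp: id_def)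
    then show "closed_map (prod_topology T X) (prod_topology T Q) (\<lambda>(g, x). (g, ?\<pi> x))"
      by (simp add: proper_map_def)
    have "continuous_map (prod_topology T X) (prod_topology T Q) (\<lambda>p. (fst p, ?\<pi> (snd p)))"
      using continuous_map_compose[OF continuous_map_snd continuous_class, unfolded o_def]
      by (intro continuous_map_pairedI continuous_map_fst) auto
    then show "continuous_map (prod_topology T X) (prod_topology T Q) (\<lambda>(g, x). (g, ?\<pi> x))"
      by (simp add: case_prod_unfold)
    show "(\<lambda>(g, x). (g, ?\<pi> x)) ` topspace (prod_topology T X) = topspace (prod_topology T Q)"
      by (auto simp: class_closed image_iff elim!: class_cases)
  qed
  have "continuous_map (prod_topology T Q) Q (\<lambda>(g, C). ?act g C)"
  proof (rule continuous_compose_quotient_map[OF prod])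
    have "continuous_map (prod_topology T X) Q (?\<pi> \<circ> (\<lambda>(g, x). act g x))"
      using continuous_action continuous_class by (rule continuous_map_compose)
    then show "continuous_map (prod_topology T X) Q ((\<lambda>(g, C). ?act g C) \<circ> (\<lambda>(g, x). (g, ?\<pi> x)))"
      by (rule continuous_map_eq) (auto simp: quotient_act_class topspace_eq)
  qed
  then show ?thesis
    using action Hausdorff_group compact_quotient Hausdorff_quotient
    by (intro tds.intro tds_axioms.intro topological_group_axioms)
qed

lemma factor_map_quotient:
  "factor_map G X act Q (quotient_act X R act) (\<lambda>x. R `` {x})"
  using continuous_class quotient_imp_surjective_map[OF quotient_map_quotient_topology[of X R]]
  by (auto simp: factor_map_def dynamical_morphism_def quotient_act_class)

end


section \<open>Rotations of compact abelian groups\<close>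

lemma topspace_uniform_topology: "topspace (uniform_topology X F) = F"
proof -
  have "openin (uniform_topology X F) F"
    unfolding openin_uniform_topology
    by (intro conjI ballI exI[of _ "topspace X \<times> topspace X"]) (auto simp: openin_prod_Times_iff)
  then show ?thesis
    by (metis openin_subset openin_topspace openin_uniform_topology subset_antisym)
qed

lemma tds_auto_mult:
  assumes "f \<in> tds_auto G X act" "h \<in> tds_auto G X act"
  shows "f \<otimes>\<^bsub>tds_AutoGroup G X act\<^esub> h = compose (topspace X) f h"
  using assms by (simp add: tds_AutoGroup_def BijGroup_def tds_auto_def)

text \<open>The inverse is a description over the restricted carrier; its uniqueness is inherited
  from the ambient group \<open>BijGroup (topspace X)\<close>.\<close>

lemma tds_auto_inv:
  assumes f: "f \<in> tds_auto G X act" and h: "h \<in> tds_auto G X act"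
    and fh: "compose (topspace X) f h = (\<lambda>x\<in>topspace X. x)"
    and hf: "compose (topspace X) h f = (\<lambda>x\<in>topspace X. x)"
  shows "inv\<^bsub>tds_AutoGroup G X act\<^esub> f = h"
proof -
  interpret B: group "BijGroup (topspace X)" by (rule group_BijGroup)
  have unique: "k = h" if k: "k \<in> tds_auto G X act" and kf: "compose (topspace X) k f = (\<lambda>x\<in>topspace X. x)" for k
  proof (rule B.inv_unique[of k f h])
    show "k \<otimes>\<^bsub>BijGroup (topspace X)\<^esub> f = \<one>\<^bsub>BijGroup (topspace X)\<^esub>"
      "f \<otimes>\<^bsub>BijGroup (topspace X)\<^esub> h = \<one>\<^bsub>BijGroup (topspace X)\<^esub>"
      using f h k kf fh by (auto simp: BijGroup_def tds_auto_def)
  qed (use f h k in \<open>auto simp: BijGroup_def tds_auto_def\<close>)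
  show ?thesis
    unfolding m_inv_def
  proof (rule the_equality)
    show "h \<in> carrier (tds_AutoGroup G X act) \<and> f \<otimes>\<^bsub>tds_AutoGroup G X act\<^esub> h = \<one>\<^bsub>tds_AutoGroup G X act\<^esub> \<and>
        h \<otimes>\<^bsub>tds_AutoGroup G X act\<^esub> f = \<one>\<^bsub>tds_AutoGroup G X act\<^esub>"
      using f h fh hf by (simp add: tds_auto_mult) (simp add: tds_AutoGroup_def BijGroup_def)
    fix k assume "k \<in> carrier (tds_AutoGroup G X act) \<and> f \<otimes>\<^bsub>tds_AutoGroup G X act\<^esub> k = \<one>\<^bsub>tds_AutoGroup G X act\<^esub> \<and>
        k \<otimes>\<^bsub>tds_AutoGroup G X act\<^esub> f = \<one>\<^bsub>tds_AutoGroup G X act\<^esub>"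
    then have "k \<in> tds_auto G X act" "k \<otimes>\<^bsub>tds_AutoGroup G X act\<^esub> f = (\<lambda>x\<in>topspace X. x)"
      by (auto simp: tds_AutoGroup_def BijGroup_def)
    then show "k = h"
      using unique tds_auto_mult[OF _ f] by metis
  qed
qed

text \<open>The acting group consists of the translations \<open>tr a\<close>. They commute with the
  action because each \<open>act g\<close> is itself a translation and the group is commutative.
  Compactness comes from continuity of \<open>tr\<close> into the uniform topology.\<close>

lemma abelian_group_tdsI:
  fixes G :: "('g, 'm) monoid_scheme" and mul :: "'y \<Rightarrow> 'y \<Rightarrow> 'y" and e :: 'y
  assumes tds: "tds G T Y act"
    and comm_group: "comm_group \<lparr>carrier = topspace Y, mult = mul, one = e\<rparr>"
    and continuous: "continuous_map (prod_topology Y Y) Y (\<lambda>(a, b). mul a b)"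
    and rotation: "\<And>g. g \<in> carrier G \<Longrightarrow> \<exists>a\<in>topspace Y. \<forall>y\<in>topspace Y. act g y = mul a y"
  shows "abelian_group_tds G T Y act"
proof -
  interpret tds G T Y act by fact
  interpret H: comm_group "\<lparr>carrier = topspace Y, mult = mul, one = e\<rparr>" by fact
  note H_simps = H.m_closed[simplified] H.m_assoc[simplified] H.m_comm[simplified] H.m_lcomm[simplified]
    H.l_one[simplified] H.r_one[simplified] H.one_closed[simplified] H.l_inv_ex[simplified]
  define tr where "tr a = (\<lambda>y\<in>topspace Y. mul a y)" for a
  have inverse: "\<exists>b\<in>topspace Y. mul a b = e" if "a \<in> topspace Y" for a
    using H.r_inv_ex[of a] that by simp
  have continuous_tr: "continuous_map Y Y (tr a)" if "a \<in> topspace Y" for a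
  proof -
    have "continuous_map Y (prod_topology Y Y) (\<lambda>y. (a, y))"
      using that by (simp add: continuous_map_pairedI)
    from continuous_map_compose[OF this continuous] show ?thesis
      by (rule continuous_map_eq) (simp add: tr_def)
  qed
  have tr_closed: "tr a y \<in> topspace Y" if "a \<in> topspace Y" "y \<in> topspace Y" for a y
    using that H_simps by (simp add: tr_def)
  have tr_mult: "compose (topspace Y) (tr a) (tr b) = tr (mul a b)"
    if "a \<in> topspace Y" "b \<in> topspace Y" for a b
    using that H_simps by (auto simp: tr_def compose_def fun_eq_iff)
  have tr_one: "tr e = (\<lambda>y\<in>topspace Y. y)"
    using H_simps by (auto simp: tr_def fun_eq_iff)
  have tr_auto: "tr a \<in> tds_auto G Y act" if a: "a \<in> topspace Y" for a
  proof -
    obtain b where b: "b \<in> topspace Y" "mul a b = e" using inverse a by blast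
    have ba: "mul b a = e" using H_simps(3)[of a b] a b by simp
    have "bij_betw (tr a) (topspace Y) (topspace Y)"
    proof (rule bij_betw_byWitness[where f' = "tr b"])
      show "\<forall>y\<in>topspace Y. tr b (tr a y) = y"
        using a b(1) ba H_simps(1,5) by (auto simp: tr_def H_simps(2)[symmetric])
      show "\<forall>y\<in>topspace Y. tr a (tr b y) = y"
        using a b H_simps(1,5) by (auto simp: tr_def H_simps(2)[symmetric])
    qed (use tr_closed a b in auto)
    moreover have "tr a (act g y) = act g (tr a y)" if g: "g \<in> carrier G" and y: "y \<in> topspace Y" for g y
    proof -
      obtain c where c: "c \<in> topspace Y" "\<forall>y\<in>topspace Y. act g y = mul c y"
        using rotation g by blast
      then show ?thesis
        using a y H_simps(1) H_simps(4)[of a c y] by (simp add: tr_def)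
    qed
    ultimately show ?thesis
      using a continuous_tr by (auto simp: tds_auto_def Bij_def dynamical_morphism_def tr_def)
  qed
  define A where "A = tr ` topspace Y"
  let ?Aut = "tds_AutoGroup G Y act"
  have A_mult: "tr a \<otimes>\<^bsub>?Aut\<^esub> tr b = tr (mul a b)" if "a \<in> topspace Y" "b \<in> topspace Y" for a b
    using that by (simp add: tds_auto_mult tr_auto tr_mult)
  have one_Aut: "\<one>\<^bsub>?Aut\<^esub> = tr e"
    by (simp add: tr_one tds_AutoGroup_def BijGroup_def)
  have subgroup: "subgroup A ?Aut"
  proof
    show "A \<subseteq> carrier ?Aut"
      by (auto simp: A_def tr_auto tds_AutoGroup_def)
    show "f \<otimes>\<^bsub>?Aut\<^esub> h \<in> A" if "f \<in> A" "h \<in> A" for f h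
      using that A_mult H_simps(1) by (auto simp: A_def)
    show "\<one>\<^bsub>?Aut\<^esub> \<in> A"
      using H_simps by (auto simp: one_Aut A_def)
    fix f assume "f \<in> A"
    then obtain a where a: "a \<in> topspace Y" "f = tr a" by (auto simp: A_def)
    obtain b where b: "b \<in> topspace Y" "mul a b = e" using inverse a by blast
    have ba: "mul b a = e" using H_simps(3)[of a b] a b by simp
    have "inv\<^bsub>?Aut\<^esub> f = tr b"
      unfolding a(2) using a(1) b ba by (intro tds_auto_inv tr_auto) (simp_all add: tr_mult tr_one)
    then show "inv\<^bsub>?Aut\<^esub> f \<in> A" using b by (simp add: A_def)
  qed
  have "comm_group (?Aut\<lparr>carrier := A\<rparr>)"
  proof (rule comm_groupI)
    show "f \<otimes>\<^bsub>?Aut\<lparr>carrier := A\<rparr>\<^esub> h \<in> carrier (?Aut\<lparr>carrier := A\<rparr>)"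
      if "f \<in> carrier (?Aut\<lparr>carrier := A\<rparr>)" "h \<in> carrier (?Aut\<lparr>carrier := A\<rparr>)" for f h
      using that A_mult H_simps(1) by (auto simp: A_def)
    show "\<one>\<^bsub>?Aut\<lparr>carrier := A\<rparr>\<^esub> \<in> carrier (?Aut\<lparr>carrier := A\<rparr>)"
      using H_simps by (auto simp: one_Aut A_def)
    show "f \<otimes>\<^bsub>?Aut\<lparr>carrier := A\<rparr>\<^esub> h \<otimes>\<^bsub>?Aut\<lparr>carrier := A\<rparr>\<^esub> k = f \<otimes>\<^bsub>?Aut\<lparr>carrier := A\<rparr>\<^esub> (h \<otimes>\<^bsub>?Aut\<lparr>carrier := A\<rparr>\<^esub> k)"
      if "f \<in> carrier (?Aut\<lparr>carrier := A\<rparr>)" "h \<in> carrier (?Aut\<lparr>carrier := A\<rparr>)"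
        "k \<in> carrier (?Aut\<lparr>carrier := A\<rparr>)" for f h k
      using that A_mult H_simps(1,2) by (auto simp: A_def)
    show "f \<otimes>\<^bsub>?Aut\<lparr>carrier := A\<rparr>\<^esub> h = h \<otimes>\<^bsub>?Aut\<lparr>carrier := A\<rparr>\<^esub> f"
      if "f \<in> carrier (?Aut\<lparr>carrier := A\<rparr>)" "h \<in> carrier (?Aut\<lparr>carrier := A\<rparr>)" for f h
      using that A_mult H_simps(3) by (auto simp: A_def)
    show "\<one>\<^bsub>?Aut\<lparr>carrier := A\<rparr>\<^esub> \<otimes>\<^bsub>?Aut\<lparr>carrier := A\<rparr>\<^esub> f = f" if "f \<in> carrier (?Aut\<lparr>carrier := A\<rparr>)" for f
      using that A_mult H_simps(5,7) by (auto simp: A_def one_Aut)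
    show "\<exists>h\<in>carrier (?Aut\<lparr>carrier := A\<rparr>). h \<otimes>\<^bsub>?Aut\<lparr>carrier := A\<rparr>\<^esub> f = \<one>\<^bsub>?Aut\<lparr>carrier := A\<rparr>\<^esub>"
      if "f \<in> carrier (?Aut\<lparr>carrier := A\<rparr>)" for f
    proof -
      from that obtain a where a: "a \<in> topspace Y" "f = tr a" by (auto simp: A_def)
      obtain b where b: "b \<in> topspace Y" "mul a b = e" using inverse a by blast
      have "tr b \<otimes>\<^bsub>?Aut\<^esub> f = tr e"
        using a b A_mult H_simps(3)[of a b] by simp
      then show ?thesis using b(1) by (auto simp: A_def one_Aut)
    qed
  qed
  moreover have "compactin (uniform_topology Y (tds_auto G Y act)) A"
  proof -
    have "continuous_map Y (uniform_topology Y (tds_auto G Y act)) tr"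
      unfolding continuous_map_def
    proof (intro conjI allI impI)
      show "tr \<in> topspace Y \<rightarrow> topspace (uniform_topology Y (tds_auto G Y act))"
        by (auto simp: topspace_uniform_topology tr_auto)
      fix U assume U: "openin (uniform_topology Y (tds_auto G Y act)) U"
      show "openin Y {a \<in> topspace Y. tr a \<in> U}"
      proof (subst openin_subopen, intro ballI)
        fix a assume "a \<in> {a \<in> topspace Y. tr a \<in> U}"
        then have a: "a \<in> topspace Y" "tr a \<in> U" by auto
        then obtain W where W: "openin (prod_topology Y Y) W" "\<forall>y\<in>topspace Y. (y, y) \<in> W"
            "{h \<in> tds_auto G Y act. \<forall>y\<in>topspace Y. (tr a y, h y) \<in> W} \<subseteq> U"
          using U unfolding openin_uniform_topology by meson
        \<comment> \<open>The second component sends \<open>(b, y)\<close> to \<open>tr b y\<close>.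
          On the slice over \<open>a\<close> both components agree, so \<open>?f\<close> maps it
          into the diagonal and thus into \<open>W\<close>; the tube lemma thickens the slice to all
          \<open>b\<close> near \<open>a\<close>, uniformly in \<open>y\<close>.\<close>
        let ?f = "\<lambda>p. (tr a (snd p), (\<lambda>(a, b). mul a b) p)"
        have "continuous_map (prod_topology Y Y) (prod_topology Y Y) ?f"
          using continuous_map_compose[OF continuous_map_snd continuous_tr[OF a(1)], unfolded o_def] continuous
          by (intro continuous_map_pairedI)
        then have "openin (prod_topology Y Y) {p \<in> topspace (prod_topology Y Y). ?f p \<in> W}"
          using W(1) by (rule openin_continuous_map_preimage)
        moreover have "{a} \<times> topspace Y \<subseteq> {p \<in> topspace (prod_topology Y Y). ?f p \<in> W}"
          using a(1) W(2) tr_closed by (auto simp: tr_def)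
        ultimately have "\<exists>V V'. openin Y V \<and> openin Y V' \<and> a \<in> V \<and> topspace Y \<subseteq> V' \<and>
            V \<times> V' \<subseteq> {p \<in> topspace (prod_topology Y Y). ?f p \<in> W}"
          using a(1) compact_phase_space unfolding compact_space_def by (intro tube_lemma_right)
        then obtain V V' where V: "openin Y V" "a \<in> V" "topspace Y \<subseteq> V'"
            "V \<times> V' \<subseteq> {p \<in> topspace (prod_topology Y Y). ?f p \<in> W}"
          by blast
        have "V \<subseteq> {a \<in> topspace Y. tr a \<in> U}"
        proof
          fix b assume b: "b \<in> V"
          then have bY: "b \<in> topspace Y" using V(1) openin_subset by blast
          have "(tr a y, tr b y) \<in> W" if y: "y \<in> topspace Y" for y
          proof -
            have "(b, y) \<in> V \<times> V'" using V(3) b y by blast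
            then have "(b, y) \<in> {p \<in> topspace (prod_topology Y Y). ?f p \<in> W}"
              using V(4) by blast
            then show ?thesis using y by (simp add: tr_def)
          qed
          then have "tr b \<in> U" using W(3) tr_auto[OF bY] by blast
          then show "b \<in> {a \<in> topspace Y. tr a \<in> U}" using bY by simp
        qed
        then show "\<exists>V. openin Y V \<and> a \<in> V \<and> V \<subseteq> {a \<in> topspace Y. tr a \<in> U}"
          using V by blast
      qed
    qed
    then show ?thesis
      unfolding A_def using compact_phase_space by (metis compact_space_def image_compactin)
  qed
  moreover have "\<exists>!k. k \<in> A \<and> k x = y" if xy: "x \<in> topspace Y" "y \<in> topspace Y" for x y
  proof -
    obtain z where z: "z \<in> topspace Y" "mul x z = e" using inverse xy by blast
    have zx: "mul z x = e" using H_simps(3)[of x z] z xy by simp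
    show ?thesis
    proof (rule ex1I[of _ "tr (mul y z)"])
      show "tr (mul y z) \<in> A \<and> tr (mul y z) x = y"
        using xy z zx H_simps(1,2,6) by (auto simp: A_def tr_def)
      fix k assume "k \<in> A \<and> k x = y"
      then obtain a where a: "a \<in> topspace Y" "k = tr a" "mul a x = y"
        using xy by (auto simp: A_def tr_def)
      have "mul y z = a" using a xy z H_simps(2,6) by auto
      then show "k = tr (mul y z)" using a by simp
    qed
  qed
  ultimately show ?thesis
    using tds subgroup unfolding abelian_group_tds_def by blast
qed


section \<open>Abelian group factors identify the pairs of the relation\<close>

text \<open>The uniform topology refines the compact-open one, since closed subsets of
  \<open>X\<close> are compact.\<close>

lemma openin_uniform_compact_open:
  assumes "compact_space X" "Hausdorff_space X" and F: "\<And>f. f \<in> F \<Longrightarrow> continuous_map X X f"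
    and C: "closedin X C" and V: "openin X V"
  shows "openin (uniform_topology X F) {h \<in> F. h ` C \<subseteq> V}"
  unfolding openin_uniform_topology
proof (intro conjI ballI)
  show "{h \<in> F. h ` C \<subseteq> V} \<subseteq> F" by blast
  fix f assume "f \<in> {h \<in> F. h ` C \<subseteq> V}"
  then have f: "f \<in> F" "f ` C \<subseteq> V" by auto
  have "compactin X (f ` C)"
    using C \<open>compact_space X\<close> F[OF f(1)] by (meson closedin_compact_space image_compactin)
  then have fC: "closedin X (f ` C)"
    using \<open>Hausdorff_space X\<close> by (rule compactin_imp_closedin[rotated])
  \<comment> \<open>A pair outside \<open>?W\<close> starts in \<open>f\<close>
    C\<open>without ending in\<close>V\<open>. The diagonal avoids such pairs because\<close>f
    \<open>C \<subseteq> V\<close>, and for \<open>x \<in> C\<close> membership of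
    \<open>(f x, h x)\<close> forces \<open>h x \<in> V\<close>.\<close>
  let ?W = "(topspace X - f ` C) \<times> topspace X \<union> topspace X \<times> V"
  show "\<exists>W. openin (prod_topology X X) W \<and> (\<forall>x \<in> topspace X. (x, x) \<in> W) \<and>
      {h \<in> F. \<forall>x \<in> topspace X. (f x, h x) \<in> W} \<subseteq> {h \<in> F. h ` C \<subseteq> V}"
  proof (intro exI[of _ ?W] conjI)
    show "openin (prod_topology X X) ?W"
      using fC V by (intro openin_Un) (auto simp: openin_prod_Times_iff)
    show "\<forall>x\<in>topspace X. (x, x) \<in> ?W" using f(2) by auto
    show "{h \<in> F. \<forall>x \<in> topspace X. (f x, h x) \<in> ?W} \<subseteq> {h \<in> F. h ` C \<subseteq> V}"
      using closedin_subset[OF C] by blast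
  qed
qed

lemma continuous_map_uniform_evaluation:
  assumes X: "compact_space X" "Hausdorff_space X" and F: "\<And>f. f \<in> F \<Longrightarrow> continuous_map X X f"
  shows "continuous_map (prod_topology (uniform_topology X F) X) X (\<lambda>(f, x). f x)"
  unfolding continuous_map_def
proof (intro conjI allI impI)
  let ?P = "prod_topology (uniform_topology X F) X"
  show "(\<lambda>(f, x). f x) \<in> topspace ?P \<rightarrow> topspace X"
    using F by (auto simp: topspace_uniform_topology continuous_map_def)
  fix V assume V: "openin X V"
  show "openin ?P {p \<in> topspace ?P. (case p of (f, x) \<Rightarrow> f x) \<in> V}"
  proof (subst openin_subopen, intro ballI)
    fix p assume "p \<in> {p \<in> topspace ?P. (case p of (f, x) \<Rightarrow> f x) \<in> V}"
    then obtain f x where p: "p = (f, x)" "f \<in> F" "x \<in> topspace X" "f x \<in> V"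
      by (auto simp: topspace_uniform_topology)
    have "openin X {y \<in> topspace X. f y \<in> V}"
      using F[OF p(2)] V by (rule openin_continuous_map_preimage)
    moreover have "neighbourhood_base_of (closedin X) X"
      using X by (simp add: neighbourhood_base_of_closedin compact_Hausdorff_imp_regular_space)
    ultimately obtain U C where UC: "openin X U" "closedin X C" "x \<in> U" "U \<subseteq> C" "C \<subseteq> {y \<in> topspace X. f y \<in> V}"
      unfolding neighbourhood_base_of using p by (metis (no_types, lifting) mem_Collect_eq)
    let ?N = "{h \<in> F. h ` C \<subseteq> V} \<times> U"
    have "openin ?P ?N"
      using UC V X F by (simp add: openin_prod_Times_iff openin_uniform_compact_open)
    moreover have "p \<in> ?N" using p UC by auto
    moreover have "?N \<subseteq> {p \<in> topspace ?P. (case p of (f, x) \<Rightarrow> f x) \<in> V}"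
      using UC(4) openin_subset[OF UC(1)] by (auto simp: topspace_uniform_topology)
    ultimately show "\<exists>N. openin ?P N \<and> p \<in> N \<and> N \<subseteq> {p \<in> topspace ?P. (case p of (f, x) \<Rightarrow> f x) \<in> V}"
      by blast
  qed
qed

section \<open>Squares and the Host-Kra group in dimension two\<close>

definition vertex :: "nat \<Rightarrow> nat \<Rightarrow> nat \<Rightarrow> nat" where
  "vertex a b = (\<lambda>i\<in>{1..2}. if i = 1 then a else b)"

lemma vertex_apply: "vertex a b 1 = a" "vertex a b (Suc 0) = a" "vertex a b 2 = b"
  by (simp_all add: vertex_def)

lemma vertex_in_cube: "a \<in> {0, 1} \<Longrightarrow> b \<in> {0, 1} \<Longrightarrow> vertex a b \<in> cube 2"
  by (auto simp: vertex_def cube_def)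

lemma group_cube_group: "group G \<Longrightarrow> group (cube_group d G)"
  by (simp add: cube_group_def)

lemma face_elem_closed:
  "group G \<Longrightarrow> h \<in> carrier G \<Longrightarrow> face_elem G d h F \<in> carrier (cube_group d G)"
  by (auto simp: face_elem_def cube_group_def group.is_monoid monoid.one_closed)

lemma HK_subset_carrier: "group G \<Longrightarrow> HK G d \<subseteq> carrier (cube_group d G)"
  unfolding HK_def using face_elem_closed
  by (intro group.generate_incl group_cube_group) auto

text \<open>A hyperface of the square is an edge and meets each of the two diagonals in exactly one
  vertex, so the generators satisfy the parallelogram relation. Commutativity of \<open>B\<close>
  makes it stable under products and inverses.\<close>

lemma HK_2_relation:
  assumes G: "group G" and B: "comm_group B" and \<alpha>: "\<alpha> \<in> hom G B" and g: "g \<in> HK G 2"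
  shows "\<alpha> (g (vertex 0 0)) \<otimes>\<^bsub>B\<^esub> \<alpha> (g (vertex 1 1)) = \<alpha> (g (vertex 0 1)) \<otimes>\<^bsub>B\<^esub> \<alpha> (g (vertex 1 0))"
proof -
  interpret G: group G by fact
  interpret B: comm_group B by fact
  interpret hom: group_hom G B \<alpha>
    using \<alpha> by unfold_locales
  define P where "P g \<longleftrightarrow> g \<in> carrier (cube_group 2 G) \<and>
    \<alpha> (g (vertex 0 0)) \<otimes>\<^bsub>B\<^esub> \<alpha> (g (vertex 1 1)) = \<alpha> (g (vertex 0 1)) \<otimes>\<^bsub>B\<^esub> \<alpha> (g (vertex 1 0))" for g
  have vG: "g (vertex a b) \<in> carrier G"
    if "g \<in> carrier (cube_group 2 G)" "a \<in> {0, 1}" "b \<in> {0, 1}" for g a b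
    using that vertex_in_cube by (auto simp: cube_group_def)
  have gen: "P (face_elem G 2 h (hyperface 2 i a))"
    if "h \<in> carrier G" "i \<in> {1..2}" "a \<in> {0, 1}" for h i a
  proof -
    have val: "face_elem G 2 h (hyperface 2 i a) (vertex b c) = (if vertex b c i = a then h else \<one>\<^bsub>G\<^esub>)"
      if "b \<in> {0, 1}" "c \<in> {0, 1}" for b c i a
      using vertex_in_cube[OF that] by (simp add: face_elem_def hyperface_def)
    have "i = 1 \<or> i = 2" "a = 0 \<or> a = 1" using that by auto
    then have "\<alpha> (face_elem G 2 h (hyperface 2 i a) (vertex 0 0)) \<otimes>\<^bsub>B\<^esub> \<alpha> (face_elem G 2 h (hyperface 2 i a) (vertex 1 1)) =
        \<alpha> (face_elem G 2 h (hyperface 2 i a) (vertex 0 1)) \<otimes>\<^bsub>B\<^esub> \<alpha> (face_elem G 2 h (hyperface 2 i a) (vertex 1 0))"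
      using \<open>h \<in> carrier G\<close> by (elim disjE) (simp_all add: val vertex_apply)
    then show ?thesis
      using face_elem_closed[OF G \<open>h \<in> carrier G\<close>] by (simp add: P_def)
  qed
  have mult: "P (f \<otimes>\<^bsub>cube_group 2 G\<^esub> h)" if f: "P f" and h: "P h" for f h
  proof -
    let ?F = "\<lambda>a b. \<alpha> (f (vertex a b))" and ?H = "\<lambda>a b. \<alpha> (h (vertex a b))"
    have c: "f \<in> carrier (cube_group 2 G)" "h \<in> carrier (cube_group 2 G)"
      using f h by (auto simp: P_def)
    have val: "(f \<otimes>\<^bsub>cube_group 2 G\<^esub> h) (vertex a b) = f (vertex a b) \<otimes>\<^bsub>G\<^esub> h (vertex a b)"
      if "a \<in> {0, 1}" "b \<in> {0, 1}" for a b
      using that vertex_in_cube by (simp add: cube_group_def)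
    have mid: "(p \<otimes>\<^bsub>B\<^esub> q) \<otimes>\<^bsub>B\<^esub> (r \<otimes>\<^bsub>B\<^esub> s) = (p \<otimes>\<^bsub>B\<^esub> r) \<otimes>\<^bsub>B\<^esub> (q \<otimes>\<^bsub>B\<^esub> s)"
      if "p \<in> carrier B" "q \<in> carrier B" "r \<in> carrier B" "s \<in> carrier B" for p q r s
      using that by (simp add: B.m_ac)
    have rel: "(?F 0 0 \<otimes>\<^bsub>B\<^esub> ?H 0 0) \<otimes>\<^bsub>B\<^esub> (?F 1 1 \<otimes>\<^bsub>B\<^esub> ?H 1 1) = (?F 0 1 \<otimes>\<^bsub>B\<^esub> ?H 0 1) \<otimes>\<^bsub>B\<^esub> (?F 1 0 \<otimes>\<^bsub>B\<^esub> ?H 1 0)"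
      (is "?l = ?r")
    proof -
      have "?l = (?F 0 0 \<otimes>\<^bsub>B\<^esub> ?F 1 1) \<otimes>\<^bsub>B\<^esub> (?H 0 0 \<otimes>\<^bsub>B\<^esub> ?H 1 1)"
        using c by (intro mid) (simp_all add: vG)
      also have "\<dots> = (?F 0 1 \<otimes>\<^bsub>B\<^esub> ?F 1 0) \<otimes>\<^bsub>B\<^esub> (?H 0 1 \<otimes>\<^bsub>B\<^esub> ?H 1 0)"
        using f h by (simp add: P_def)
      also have "\<dots> = ?r"
        using c by (intro mid) (simp_all add: vG)
      finally show ?thesis .
    qed
    have "f \<otimes>\<^bsub>cube_group 2 G\<^esub> h \<in> carrier (cube_group 2 G)"
      using c group.is_monoid[OF group_cube_group[OF G]] by (intro monoid.m_closed)
    then show ?thesis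
      using rel c by (simp add: P_def vG val)
  qed
  have inv: "P (inv\<^bsub>cube_group 2 G\<^esub> f)" if f: "P f" for f
  proof -
    have c: "f \<in> carrier (cube_group 2 G)" using f by (simp add: P_def)
    have "inv\<^bsub>cube_group 2 G\<^esub> f \<in> carrier (cube_group 2 G)"
      using c by (rule group.inv_closed[OF group_cube_group[OF G]])
    moreover have "(inv\<^bsub>cube_group 2 G\<^esub> f) (vertex a b) = inv\<^bsub>G\<^esub> (f (vertex a b))"
      if "a \<in> {0, 1}" "b \<in> {0, 1}" for a b
      using that vertex_in_cube c G by (simp add: cube_group_def)
    ultimately show ?thesis
      using f by (simp add: P_def vG B.inv_mult[symmetric])
  qed
  have "P g"
    using g unfolding HK_def
  proof (induction rule: generate.induct)
    case one
    then show ?case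
      using group.is_monoid[OF group_cube_group[OF G]] vertex_in_cube
      by (auto simp: P_def intro: monoid.one_closed) (simp add: cube_group_def)
  qed (use gen mult inv in auto)
  then show ?thesis by (simp add: P_def)
qed

lemma continuous_map_vertex:
  "\<omega> \<in> cube d \<Longrightarrow> continuous_map (cube_topology d X) X (\<lambda>c. c \<omega>)"
  using continuous_map_product_projection[of \<omega> "cube d" "\<lambda>_. X"] by (simp add: cube_topology_def)

text \<open>\<open>G\<close> acts on \<open>K\<close> through a homomorphism \<open>\<alpha>\<close>
  into a commutative group \<open>A\<close>. By the parallelogram relation the generating squares of
  \<open>X\<close> are sent by \<open>\<phi>\<close> into the closed set \<open>D\<close> of
  parallelograms \<open>(k, a k, b k, a (b k))\<close>, and so are their limits. A parallelogram
  whose first three vertices coincide is constant.\<close>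

lemma NRP1_abelian_group_factor:
  fixes G :: "('g, 'm) monoid_scheme" and K :: "'k topology"
  assumes X: "tds G T X act" and K: "abelian_group_tds G T K actK"
    and \<phi>: "dynamical_morphism G X act K actK \<phi>"
    and xy: "(x, y) \<in> NRP1 G X act"
  shows "\<phi> x = \<phi> y"
proof -
  interpret tds G T X act by fact
  from K obtain A where K_tds: "tds G T K actK"
    and sub: "subgroup A (tds_AutoGroup G K actK)"
    and A_comm: "comm_group (tds_AutoGroup G K actK\<lparr>carrier := A\<rparr>)"
    and A_compact: "compactin (uniform_topology K (tds_auto G K actK)) A"
    and trans: "\<forall>x\<in>topspace K. \<forall>y\<in>topspace K. \<exists>!k. k \<in> A \<and> k x = y"
    unfolding abelian_group_tds_def by (elim conjE exE) (rule that)
  have A_trans: "\<exists>!k. k \<in> A \<and> k x = y" if "x \<in> topspace K" "y \<in> topspace K" for x y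
    using trans[rule_format, OF that] .
  interpret K: tds G T K actK by fact
  define H where "H = tds_AutoGroup G K actK\<lparr>carrier := A\<rparr>"
  have carrier_H [simp]: "carrier H = A" by (simp add: H_def)
  interpret H: comm_group H using A_comm by (simp add: H_def)
  have A_auto: "a \<in> tds_auto G K actK" if "a \<in> A" for a
    using subgroup.subset[OF sub] that by (auto simp: tds_AutoGroup_def)
  have A_closed: "a k \<in> topspace K" if "a \<in> A" "k \<in> topspace K" for a k
    using A_auto[OF that(1)] that(2) by (auto simp: tds_auto_def dynamical_morphism_def continuous_map_def)
  have A_mult: "(a \<otimes>\<^bsub>H\<^esub> b) k = a (b k)" if "a \<in> A" "b \<in> A" "k \<in> topspace K" for a b k
    using that tds_auto_mult[OF A_auto A_auto] by (simp add: H_def compose_def)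
  have A_act: "a (actK g k) = actK g (a k)" if "a \<in> A" "g \<in> carrier G" "k \<in> topspace K" for a g k
    using A_auto[OF that(1)] that(2,3) by (simp add: tds_auto_def dynamical_morphism_def)
  have A_commute: "a (b k) = b (a k)" if "a \<in> A" "b \<in> A" "k \<in> topspace K" for a b k
    using that H.m_comm[of a b] A_mult[of a b k] A_mult[of b a k] by simp
  have xyX: "x \<in> topspace X" "y \<in> topspace X" using xy by (auto simp: NRP1_def)
  have \<phi>_closed: "\<phi> z \<in> topspace K" if "z \<in> topspace X" for z
    using \<phi> that by (auto simp: dynamical_morphism_def continuous_map_def)
  define k0 where "k0 = \<phi> x"
  have k0: "k0 \<in> topspace K" using \<phi>_closed xyX by (simp add: k0_def)
  define \<alpha> where "\<alpha> g = (THE a. a \<in> A \<and> a k0 = actK g k0)" for g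
  have \<alpha>0: "\<alpha> g \<in> A \<and> \<alpha> g k0 = actK g k0" if "g \<in> carrier G" for g
    unfolding \<alpha>_def using theI'[OF A_trans[OF k0 K.act_closed[OF that k0]]] .
  \<comment> \<open>Both maps commute with \<open>A\<close> and agree at \<open>k0\<close>;
    transitivity of \<open>A\<close> spreads the agreement to every point.\<close>
  have \<alpha>: "\<alpha> g k = actK g k" if g: "g \<in> carrier G" and k: "k \<in> topspace K" for g k
  proof -
    obtain b where b: "b \<in> A" "b k0 = k" using A_trans[OF k0 k] by blast
    have "\<alpha> g k = b (\<alpha> g k0)" using A_commute \<alpha>0[OF g] b k0 by metis
    then show ?thesis using \<alpha>0[OF g] A_act[OF b(1) g k0] b(2) by simp
  qed
  have hom: "\<alpha> \<in> hom G H"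
  proof (rule homI)
    show "\<alpha> g \<in> carrier H" if "g \<in> carrier G" for g using \<alpha>0 that by simp
    fix g h assume gh: "g \<in> carrier G" "h \<in> carrier G"
    have "(\<alpha> g \<otimes>\<^bsub>H\<^esub> \<alpha> h) k0 = \<alpha> (g \<otimes>\<^bsub>G\<^esub> h) k0"
      using gh k0 A_mult \<alpha>0 \<alpha> K.act_mult K.act_closed by simp
    moreover have "\<alpha> g \<otimes>\<^bsub>H\<^esub> \<alpha> h \<in> A" "\<alpha> (g \<otimes>\<^bsub>G\<^esub> h) \<in> A"
      using gh \<alpha>0 H.m_closed[of "\<alpha> g" "\<alpha> h"] by auto
    ultimately show "\<alpha> (g \<otimes>\<^bsub>G\<^esub> h) = \<alpha> g \<otimes>\<^bsub>H\<^esub> \<alpha> h"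
      using A_trans[OF k0 A_closed[OF \<open>\<alpha> (g \<otimes>\<^bsub>G\<^esub> h) \<in> A\<close> k0]] by metis
  qed
  let ?U = "uniform_topology K (tds_auto G K actK)"
  let ?K4 = "prod_topology K (prod_topology K (prod_topology K K))"
  \<comment> \<open>The vertices are listed in the order 00, 01, 10, 11, matching
    \<open>\<Psi>\<close>. Joint continuity of evaluation makes the image \<open>D\<close>
    compact.\<close>
  define f where "f = (\<lambda>(k, a, b). (k, a k, b k, a (b k)) :: 'k \<times> 'k \<times> 'k \<times> 'k)"
  define D where "D = f ` (topspace K \<times> A \<times> A)"
  have "compactin ?K4 D"
    unfolding D_def
  proof (rule image_compactin)
    show "compactin (prod_topology K (prod_topology ?U ?U)) (topspace K \<times> A \<times> A)"
      using A_compact K.compact_phase_space by (simp add: compactin_Times compact_space_def)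
    let ?P = "prod_topology K (prod_topology ?U ?U)"
    have ev: "continuous_map ?P K (\<lambda>p. (\<lambda>(a, k). a k) (h p, l p))"
      if "continuous_map ?P ?U h" "continuous_map ?P K l" for h l
    proof -
      have "continuous_map ?P (prod_topology ?U K) (\<lambda>p. (h p, l p))"
        using that by (rule continuous_map_pairedI)
      from continuous_map_compose[OF this continuous_map_uniform_evaluation] show ?thesis
        using K.compact_phase_space K.Hausdorff_phase_space
        by (auto simp: o_def tds_auto_def dynamical_morphism_def)
    qed
    have [intro]: "continuous_map ?P K fst" "continuous_map ?P ?U (\<lambda>p. fst (snd p))"
      "continuous_map ?P ?U (\<lambda>p. snd (snd p))"
      using continuous_map_compose[OF continuous_map_snd continuous_map_fst, unfolded o_def]
        continuous_map_compose[OF continuous_map_snd continuous_map_snd, unfolded o_def]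
      by (auto intro: continuous_map_fst)
    have 1: "continuous_map ?P K (\<lambda>p. snd (snd p) (fst p))"
      using ev[of "\<lambda>p. snd (snd p)" fst] by auto
    have 2: "continuous_map ?P K (\<lambda>p. fst (snd p) (fst p))"
      using ev[of "\<lambda>p. fst (snd p)" fst] by auto
    have 3: "continuous_map ?P K (\<lambda>p. fst (snd p) (snd (snd p) (fst p)))"
      using ev[of "\<lambda>p. fst (snd p)" "\<lambda>p. snd (snd p) (fst p)"] 1 by auto
    show "continuous_map ?P ?K4 f"
      unfolding f_def case_prod_unfold using 1 2 3 by (intro continuous_map_pairedI) auto
  qed
  then have D_closed: "closedin ?K4 D"
    using K.Hausdorff_phase_space by (intro compactin_imp_closedin) (simp_all add: Hausdorff_space_prod_topology)
  define \<Psi> where "\<Psi> c = (\<phi> (c (vertex 0 0)), \<phi> (c (vertex 0 1)), \<phi> (c (vertex 1 0)), \<phi> (c (vertex 1 1)))" for c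
  have \<Psi>: "continuous_map (cube_topology 2 X) ?K4 \<Psi>"
  proof -
    have "continuous_map (cube_topology 2 X) K (\<lambda>c. \<phi> (c \<omega>))" if "\<omega> \<in> cube 2" for \<omega>
      using continuous_map_compose[OF continuous_map_vertex[OF that]] \<phi>
      by (auto simp: dynamical_morphism_def o_def)
    then show ?thesis
      unfolding \<Psi>_def using vertex_in_cube by (intro continuous_map_pairedI) auto
  qed
  have orbits: "\<Psi> (cube_act 2 act g (cube_const 2 z)) \<in> D" if g: "g \<in> HK G 2" and z: "z \<in> topspace X" for g z
  proof -
    have gG: "g (vertex a b) \<in> carrier G" if "a \<in> {0, 1}" "b \<in> {0, 1}" for a b
      using HK_subset_carrier[OF is_group, of 2] g vertex_in_cube[OF that] by (auto simp: cube_group_def)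
    have val: "\<phi> (cube_act 2 act g (cube_const 2 z) (vertex a b)) = \<alpha> (g (vertex a b)) (\<phi> z)"
      if "a \<in> {0, 1}" "b \<in> {0, 1}" for a b
      using that vertex_in_cube gG[OF that] z \<phi> \<phi>_closed
      by (simp add: cube_act_def cube_const_def \<alpha> dynamical_morphism_def)
    let ?a = "\<lambda>i j. \<alpha> (g (vertex i j))"
    have aA: "?a i j \<in> A" if "i \<in> {0, 1}" "j \<in> {0, 1}" for i j
      using \<alpha>0 gG[OF that] by blast
    \<comment> \<open>\<open>p\<close> and \<open>q\<close> lead from vertex 00 to 01 and to 10; the
      parallelogram relation forces their product to lead to 11.\<close>
    define p where "p = ?a 0 1 \<otimes>\<^bsub>H\<^esub> inv\<^bsub>H\<^esub> ?a 0 0"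
    define q where "q = ?a 1 0 \<otimes>\<^bsub>H\<^esub> inv\<^bsub>H\<^esub> ?a 0 0"
    have pq: "p \<in> A" "q \<in> A"
      using aA H.m_closed H.inv_closed unfolding p_def q_def by simp_all
    have rel: "?a 0 0 \<otimes>\<^bsub>H\<^esub> ?a 1 1 = ?a 0 1 \<otimes>\<^bsub>H\<^esub> ?a 1 0"
      using is_group H.comm_group_axioms hom g by (rule HK_2_relation)
    have e1: "p \<otimes>\<^bsub>H\<^esub> ?a 0 0 = ?a 0 1" "q \<otimes>\<^bsub>H\<^esub> ?a 0 0 = ?a 1 0"
      using aA H.inv_closed unfolding p_def q_def by (simp_all add: H.m_assoc)
    have "?a 0 0 \<otimes>\<^bsub>H\<^esub> (p \<otimes>\<^bsub>H\<^esub> (q \<otimes>\<^bsub>H\<^esub> ?a 0 0)) = ?a 0 0 \<otimes>\<^bsub>H\<^esub> ?a 1 1"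
    proof -
      have "?a 0 0 \<otimes>\<^bsub>H\<^esub> (p \<otimes>\<^bsub>H\<^esub> (q \<otimes>\<^bsub>H\<^esub> ?a 0 0)) = (p \<otimes>\<^bsub>H\<^esub> ?a 0 0) \<otimes>\<^bsub>H\<^esub> (q \<otimes>\<^bsub>H\<^esub> ?a 0 0)"
        using pq[folded carrier_H] aA[of 0 0, folded carrier_H] by (simp add: H.m_ac del: carrier_H)
      then show ?thesis by (simp only: e1 rel)
    qed
    then have e2: "p \<otimes>\<^bsub>H\<^esub> (q \<otimes>\<^bsub>H\<^esub> ?a 0 0) = ?a 1 1"
      using pq[folded carrier_H] aA[of 0 0, folded carrier_H] aA[of 1 1, folded carrier_H]
      by (simp del: carrier_H One_nat_def)
    have "p (q (?a 0 0 (\<phi> z))) = ?a 1 1 (\<phi> z)"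
      unfolding e2[symmetric]
      using pq aA[of 0 0] \<phi>_closed[OF z] H.m_closed[of q "?a 0 0"] by (simp add: A_mult)
    moreover have "p (?a 0 0 (\<phi> z)) = ?a 0 1 (\<phi> z)" "q (?a 0 0 (\<phi> z)) = ?a 1 0 (\<phi> z)"
      unfolding e1[symmetric] using pq aA[of 0 0] \<phi>_closed[OF z] by (simp_all add: A_mult)
    ultimately have "\<Psi> (cube_act 2 act g (cube_const 2 z)) = f (?a 0 0 (\<phi> z), p, q)"
      by (simp add: \<Psi>_def f_def val)
    then show ?thesis
      unfolding D_def using pq aA A_closed \<phi>_closed[OF z] by auto
  qed
  have "lower_corner x y \<in> cube_topology 2 X closure_of
      {cube_act 2 act g (cube_const 2 z) | g z. g \<in> HK G 2 \<and> z \<in> topspace X}"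
    using xy by (simp add: NRP1_def dynamical_cubes_def)
  then have "\<Psi> (lower_corner x y) \<in> D"
    by (rule forall_in_closure_of) (use orbits closedin_continuous_map_preimage[OF \<Psi> D_closed] in auto)
  then obtain k a b where ab: "k \<in> topspace K" "a \<in> A" "b \<in> A" "\<Psi> (lower_corner x y) = (k, a k, b k, a (b k))"
    by (auto simp: D_def f_def)
  \<comment> \<open>So \<open>a\<close> and \<open>b\<close> both fix \<open>k = \<phi> x\<close>,
    and the last vertex \<open>a (b k)\<close> is \<open>\<phi> x\<close> again.\<close>
  then have "\<phi> x = k" "\<phi> x = a k" "\<phi> x = b k" "\<phi> y = a (b k)"
    using vertex_in_cube by (auto simp: \<Psi>_def lower_corner_def vertex_apply)
  then show ?thesis by metis
qed


section \<open>Quotients by the fibres of an abelian coordinate\<close>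

text \<open>
  No topology on \<open>B\<close> is given: the compact set \<open>W\<close> is a partial graph of the group
  operation seen from \<open>X\<close>, and it is all that is needed to make the quotient Hausdorff
  and the induced operation continuous.
\<close>

locale abelian_coordinate = tds G T X act
  for G :: "('g, 'm) monoid_scheme" (structure) and T X and act :: "'g \<Rightarrow> 'x \<Rightarrow> 'x" +
  fixes B :: "('b, 'n) monoid_scheme" and \<alpha> :: "'g \<Rightarrow> 'b" and \<beta> :: "'x \<Rightarrow> 'b"
    and W :: "('x \<times> 'x \<times> 'x) set"
  assumes comm_group: "comm_group B"
    and \<alpha>_closed: "g \<in> carrier G \<Longrightarrow> \<alpha> g \<in> carrier B"
    and \<beta>_image: "\<beta> ` topspace X = carrier B"
    and \<beta>_act: "g \<in> carrier G \<Longrightarrow> x \<in> topspace X \<Longrightarrow> \<beta> (act g x) = \<alpha> g \<otimes>\<^bsub>B\<^esub> \<beta> x"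
    and W_compact: "compactin (prod_topology X (prod_topology X X)) W"
    and W_mult: "(x, y, z) \<in> W \<Longrightarrow> \<beta> z = \<beta> x \<otimes>\<^bsub>B\<^esub> \<beta> y"
    and W_total: "x \<in> topspace X \<Longrightarrow> y \<in> topspace X \<Longrightarrow> \<exists>z. (x, y, z) \<in> W"
    and fibre_closed: "closedin X {x \<in> topspace X. \<beta> x = \<one>\<^bsub>B\<^esub>}"
begin

sublocale B: comm_group B by (fact comm_group)

definition fibres :: "('x \<times> 'x) set" where
  "fibres = {(x, y) \<in> topspace X \<times> topspace X. \<beta> x = \<beta> y}"

lemma \<beta>_closed: "x \<in> topspace X \<Longrightarrow> \<beta> x \<in> carrier B"
  using \<beta>_image by blast

lemma W_topspace: "(x, y, z) \<in> W \<Longrightarrow> x \<in> topspace X \<and> y \<in> topspace X \<and> z \<in> topspace X"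
  using compactin_subset_topspace[OF W_compact] by auto

lemma compactin_W_over:
  assumes "closedin X F"
  shows "compactin (prod_topology X X) {(x, y). \<exists>z\<in>F. (x, y, z) \<in> W}"
proof -
  let ?P = "prod_topology X (prod_topology X X)"
  have "continuous_map ?P X (\<lambda>p. snd (snd p))"
    using continuous_map_compose[OF continuous_map_snd continuous_map_snd, unfolded o_def] .
  then have "closedin ?P {p \<in> topspace ?P. snd (snd p) \<in> F}"
    using assms by (rule closedin_continuous_map_preimage)
  then have "compactin ?P ({p \<in> topspace ?P. snd (snd p) \<in> F} \<inter> W)"
    using W_compact by (rule closed_Int_compactin)
  moreover have "continuous_map ?P (prod_topology X X) (\<lambda>p. (fst p, fst (snd p)))"
    using continuous_map_compose[OF continuous_map_snd continuous_map_fst, unfolded o_def]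
    by (intro continuous_map_pairedI continuous_map_fst) auto
  ultimately have "compactin (prod_topology X X)
      ((\<lambda>p. (fst p, fst (snd p))) ` ({p \<in> topspace ?P. snd (snd p) \<in> F} \<inter> W))"
    by (rule image_compactin)
  moreover have "(\<lambda>p. (fst p, fst (snd p))) ` ({p \<in> topspace ?P. snd (snd p) \<in> F} \<inter> W) =
      {(x, y). \<exists>z\<in>F. (x, y, z) \<in> W}"
    using compactin_subset_topspace[OF W_compact] by (force simp: image_iff)
  ultimately show ?thesis by simp
qed

text \<open>The pairs with mutually inverse coordinates form a compact set \<open>Z\<close>, lying
  over the closed fibre of the unit. Two points share a coordinate iff some \<open>z\<close> is
  inverse to both, so \<open>fibres\<close> is a relational composite of \<open>Z\<close> with its
  converse.\<close>

lemma closedin_fibres: "closedin (prod_topology X X) fibres"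
proof -
  let ?XX = "prod_topology X X" and ?F = "{x \<in> topspace X. \<beta> x = \<one>\<^bsub>B\<^esub>}"
  define Z where "Z = {(x, y). \<exists>z\<in>?F. (x, y, z) \<in> W}"
  have "compactin ?XX Z"
    unfolding Z_def using fibre_closed by (rule compactin_W_over)
  have Z: "(x, y) \<in> Z \<longleftrightarrow> \<beta> x \<otimes>\<^bsub>B\<^esub> \<beta> y = \<one>\<^bsub>B\<^esub>" if "x \<in> topspace X" "y \<in> topspace X" for x y
    using W_total[OF that] W_mult W_topspace by (fastforce simp: Z_def)
  have Z_topspace: "x \<in> topspace X \<and> y \<in> topspace X" if "(x, y) \<in> Z" for x y
    using that W_topspace by (auto simp: Z_def)
  have "continuous_map (prod_topology ?XX ?XX) X (\<lambda>p. snd (fst p))"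
    "continuous_map (prod_topology ?XX ?XX) X (\<lambda>p. snd (snd p))"
    "continuous_map (prod_topology ?XX ?XX) X (\<lambda>p. fst (fst p))"
    "continuous_map (prod_topology ?XX ?XX) X (\<lambda>p. fst (snd p))"
    using continuous_map_compose[OF continuous_map_snd continuous_map_snd, unfolded o_def]
      continuous_map_compose[OF continuous_map_fst continuous_map_snd, unfolded o_def]
      continuous_map_compose[OF continuous_map_snd continuous_map_fst, unfolded o_def]
      continuous_map_compose[OF continuous_map_fst continuous_map_fst, unfolded o_def]
    by blast+
  note cont = this
  \<comment> \<open>Pairs of elements of \<open>Z\<close> with the same second component; keeping
    the two first components performs the composition.\<close>
  let ?E = "{p \<in> topspace (prod_topology ?XX ?XX). snd (fst p) = snd (snd p)} \<inter> Z \<times> Z"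
  have "compactin (prod_topology ?XX ?XX) ?E"
    using cont Hausdorff_phase_space \<open>compactin ?XX Z\<close>
    by (intro closed_Int_compactin closedin_continuous_maps_eq) (auto simp: compactin_Times)
  then have "compactin ?XX ((\<lambda>p. (fst (fst p), fst (snd p))) ` ?E)"
    using cont by (intro image_compactin continuous_map_pairedI)
  moreover have "(\<lambda>p. (fst (fst p), fst (snd p))) ` ?E = fibres"
  proof (intro equalityI subsetI)
    fix q assume "q \<in> (\<lambda>p. (fst (fst p), fst (snd p))) ` ?E"
    then obtain x y z where q: "q = (x, y)" "(x, z) \<in> Z" "(y, z) \<in> Z" by auto
    then have "\<beta> x \<otimes>\<^bsub>B\<^esub> \<beta> z = \<beta> y \<otimes>\<^bsub>B\<^esub> \<beta> z" using Z Z_topspace by metis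
    then show "q \<in> fibres"
      using q Z_topspace \<beta>_closed by (auto simp: fibres_def)
  next
    fix q assume "q \<in> fibres"
    then obtain x y where q: "q = (x, y)" "x \<in> topspace X" "y \<in> topspace X" "\<beta> x = \<beta> y"
      by (auto simp: fibres_def)
    obtain z where z: "z \<in> topspace X" "\<beta> z = inv\<^bsub>B\<^esub> \<beta> x"
      using \<beta>_image B.inv_closed[OF \<beta>_closed[OF q(2)]] by force
    then have "(x, z) \<in> Z" "(y, z) \<in> Z"
      using q Z \<beta>_closed by simp_all
    then have "((x, z), (y, z)) \<in> ?E" using q z by simp
    then have "(\<lambda>p. (fst (fst p), fst (snd p))) ((x, z), (y, z)) \<in> (\<lambda>p. (fst (fst p), fst (snd p))) ` ?E"
      by (rule imageI)
    then show "q \<in> (\<lambda>p. (fst (fst p), fst (snd p))) ` ?E"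
      using q(1) by simp
  qed
  ultimately show ?thesis
    using Hausdorff_phase_space by (simp add: compactin_imp_closedin Hausdorff_space_prod_topology)
qed

sublocale congruence: tds_congruence G T X act fibres
proof
  show "equiv (topspace X) fibres"
    by (auto simp: equiv_def fibres_def refl_on_def intro!: symI transI)
  show "(act g x, act g y) \<in> fibres" if "g \<in> carrier G" "(x, y) \<in> fibres" for g x y
    using that by (auto simp: fibres_def \<beta>_act act_closed)
qed (fact closedin_fibres)

text \<open>Classes correspond to elements of \<open>B\<close> through \<open>\<kappa>\<close>,
  which carries the group law over. Continuity is checked on closed sets: the preimage of
  \<open>F\<close> is the image of the compact set of pairs that \<open>W\<close> completes by a
  point over \<open>F\<close>.\<close>

lemma abelian_group_tds_quotient:
  "abelian_group_tds G T (quotient_topology X fibres) (quotient_act X fibres act)"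
proof -
  let ?Q = "quotient_topology X fibres" and ?\<pi> = "\<lambda>x. fibres `` {x}"
  define \<kappa> where "\<kappa> b = {x \<in> topspace X. \<beta> x = b}" for b
  \<comment> \<open>\<open>\<beta>\<close> is constant on each class, so the chosen representatives
    do not affect the value.\<close>
  define mul where "mul C D = \<kappa> (\<beta> (SOME x. x \<in> C) \<otimes>\<^bsub>B\<^esub> \<beta> (SOME y. y \<in> D))" for C D
  have \<pi>: "?\<pi> x = \<kappa> (\<beta> x)" if "x \<in> topspace X" for x
    using that by (auto simp: fibres_def \<kappa>_def)
  have \<kappa>_some: "\<beta> (SOME x. x \<in> \<kappa> b) = b" if "b \<in> carrier B" for b
  proof -
    have "\<exists>x. x \<in> \<kappa> b" using that unfolding \<beta>_image[symmetric] by (auto simp: \<kappa>_def)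
    then have "(SOME x. x \<in> \<kappa> b) \<in> \<kappa> b" by (rule someI_ex)
    then show ?thesis by (simp add: \<kappa>_def)
  qed
  have mul: "mul (\<kappa> a) (\<kappa> b) = \<kappa> (a \<otimes>\<^bsub>B\<^esub> b)" if "a \<in> carrier B" "b \<in> carrier B" for a b
    using that by (simp add: mul_def \<kappa>_some)
  have topspace_Q: "topspace ?Q = \<kappa> ` carrier B"
  proof -
    have "topspace ?Q = ?\<pi> ` topspace X"
      using quotient_imp_surjective_map[OF quotient_map_quotient_topology] by metis
    also have "\<dots> = \<kappa> ` \<beta> ` topspace X" by (auto simp: \<pi>)
    finally show ?thesis by (simp add: \<beta>_image)
  qed
  show ?thesis
  proof (rule abelian_group_tdsI[where mul = mul and e = "\<kappa> \<one>\<^bsub>B\<^esub>"])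
    show "tds G T ?Q (quotient_act X fibres act)"
      by (rule congruence.tds_quotient)
    show "comm_group \<lparr>carrier = topspace ?Q, mult = mul, one = \<kappa> \<one>\<^bsub>B\<^esub>\<rparr>"
    proof (rule comm_groupI)
      fix C assume "C \<in> carrier \<lparr>carrier = topspace ?Q, mult = mul, one = \<kappa> \<one>\<^bsub>B\<^esub>\<rparr>"
      then obtain a where a: "a \<in> carrier B" "C = \<kappa> a" by (auto simp: topspace_Q)
      then have "mul (\<kappa> (inv\<^bsub>B\<^esub> a)) C = \<kappa> \<one>\<^bsub>B\<^esub>" by (simp add: mul)
      then show "\<exists>D\<in>carrier \<lparr>carrier = topspace ?Q, mult = mul, one = \<kappa> \<one>\<^bsub>B\<^esub>\<rparr>.
          D \<otimes>\<^bsub>\<lparr>carrier = topspace ?Q, mult = mul, one = \<kappa> \<one>\<^bsub>B\<^esub>\<rparr>\<^esub> C =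
          \<one>\<^bsub>\<lparr>carrier = topspace ?Q, mult = mul, one = \<kappa> \<one>\<^bsub>B\<^esub>\<rparr>\<^esub>"
        using a by (auto simp: topspace_Q)
    qed (auto simp: topspace_Q mul B.m_ac)
    show "\<exists>C\<in>topspace ?Q. \<forall>D\<in>topspace ?Q. quotient_act X fibres act g D = mul C D" if "g \<in> carrier G" for g
    proof (intro bexI ballI)
      show "\<kappa> (\<alpha> g) \<in> topspace ?Q" using that \<alpha>_closed by (simp add: topspace_Q)
      fix D assume "D \<in> topspace ?Q"
      then obtain x where x: "x \<in> topspace X" "D = ?\<pi> x" by (rule congruence.class_cases)
      have "quotient_act X fibres act g D = ?\<pi> (act g x)"
        using x that by (simp add: congruence.quotient_act_class)
      also have "\<dots> = mul (\<kappa> (\<alpha> g)) D"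
        using x that by (simp add: \<pi> act_closed \<beta>_act mul \<alpha>_closed \<beta>_closed)
      finally show "quotient_act X fibres act g D = mul (\<kappa> (\<alpha> g)) D" .
    qed
    show "continuous_map (prod_topology ?Q ?Q) ?Q (\<lambda>(C, D). mul C D)"
      unfolding continuous_map_closedin
    proof (intro conjI ballI allI impI)
      show "(\<lambda>(C, D). mul C D) \<in> topspace (prod_topology ?Q ?Q) \<rightarrow> topspace ?Q"
        by (auto simp: topspace_Q mul)
      fix F assume F: "closedin ?Q F"
      let ?V = "{(x, y). \<exists>z\<in>{x \<in> topspace X. ?\<pi> x \<in> F}. (x, y, z) \<in> W}"
      have "closedin X {x \<in> topspace X. ?\<pi> x \<in> F}"
        using congruence.continuous_class F by (rule closedin_continuous_map_preimage)
      then have "compactin (prod_topology X X) ?V"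
        by (rule compactin_W_over)
      moreover have "continuous_map (prod_topology X X) (prod_topology ?Q ?Q) (\<lambda>p. (?\<pi> (fst p), ?\<pi> (snd p)))"
        using continuous_map_compose[OF continuous_map_fst congruence.continuous_class, unfolded o_def]
          continuous_map_compose[OF continuous_map_snd congruence.continuous_class, unfolded o_def]
        by (intro continuous_map_pairedI)
      ultimately have "compactin (prod_topology ?Q ?Q) ((\<lambda>p. (?\<pi> (fst p), ?\<pi> (snd p))) ` ?V)"
        by (rule image_compactin)
      then have "closedin (prod_topology ?Q ?Q) ((\<lambda>p. (?\<pi> (fst p), ?\<pi> (snd p))) ` ?V)"
        by (intro compactin_imp_closedin) (simp add: Hausdorff_space_prod_topology congruence.Hausdorff_quotient)
      moreover have "(\<lambda>p. (?\<pi> (fst p), ?\<pi> (snd p))) ` ?V =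
          {p \<in> topspace (prod_topology ?Q ?Q). (case p of (C, D) \<Rightarrow> mul C D) \<in> F}"
      proof (intro equalityI subsetI)
        fix p assume "p \<in> (\<lambda>p. (?\<pi> (fst p), ?\<pi> (snd p))) ` ?V"
        then obtain x y z where p: "p = (?\<pi> x, ?\<pi> y)" "(x, y, z) \<in> W" "?\<pi> z \<in> F" by auto
        then show "p \<in> {p \<in> topspace (prod_topology ?Q ?Q). (case p of (C, D) \<Rightarrow> mul C D) \<in> F}"
          using W_topspace[OF p(2)] W_mult[OF p(2)] congruence.class_closed
          by (simp add: \<pi> mul \<beta>_closed topspace_Q)
      next
        fix p assume "p \<in> {p \<in> topspace (prod_topology ?Q ?Q). (case p of (C, D) \<Rightarrow> mul C D) \<in> F}"
        then obtain C D where CD: "p = (C, D)" "C \<in> topspace ?Q" "D \<in> topspace ?Q" "mul C D \<in> F" by auto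
        obtain x where x: "x \<in> topspace X" "C = ?\<pi> x" using CD(2) by (rule congruence.class_cases)
        obtain y where y: "y \<in> topspace X" "D = ?\<pi> y" using CD(3) by (rule congruence.class_cases)
        obtain z where z: "(x, y, z) \<in> W" using W_total x y by blast
        have "?\<pi> z = mul C D"
          using x y W_topspace[OF z] W_mult[OF z] by (simp add: \<pi> mul \<beta>_closed)
        then have "(x, y) \<in> ?V" using z W_topspace[OF z] CD by auto
        then show "p \<in> (\<lambda>p. (?\<pi> (fst p), ?\<pi> (snd p))) ` ?V"
          using CD(1) x(2) y(2) by (intro image_eqI[of _ _ "(x, y)"]) simp_all
      qed
      ultimately show "closedin (prod_topology ?Q ?Q) {p \<in> topspace (prod_topology ?Q ?Q). (case p of (C, D) \<Rightarrow> mul C D) \<in> F}"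
        by simp
    qed
  qed
qed

end


section \<open>The enveloping semigroup of a minimal system\<close>

locale enveloping_semigroup = minimal_tds G T X act
  for G :: "('g, 'm) monoid_scheme" (structure) and T and X :: "'x topology" and act
begin

abbreviation composition :: "('x \<Rightarrow> 'x) \<Rightarrow> ('x \<Rightarrow> 'x) \<Rightarrow> 'x \<Rightarrow> 'x" (infixl \<open>\<cdot>\<close> 70) where
  "f \<cdot> h \<equiv> compose (topspace X) f h"

definition maps :: "('x \<Rightarrow> 'x) topology" where
  "maps = product_topology (\<lambda>_. X) (topspace X)"

text \<open>Componentwise composition, in the nested shape produced by applying
  \<open>compact_right_semigroup_prod\<close> twice.\<close>

definition triple_mult ::
  "('x \<Rightarrow> 'x) \<times> ('x \<Rightarrow> 'x) \<times> ('x \<Rightarrow> 'x) \<Rightarrow> ('x \<Rightarrow> 'x) \<times> ('x \<Rightarrow> 'x) \<times> ('x \<Rightarrow> 'x) \<Rightarrow>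
    ('x \<Rightarrow> 'x) \<times> ('x \<Rightarrow> 'x) \<times> ('x \<Rightarrow> 'x)" where
  "triple_mult = (\<lambda>(a, p) (b, q). (a \<cdot> b, (\<lambda>(c, d) (c', d'). (c \<cdot> c', d \<cdot> d')) p q))"

lemma triple_mult_apply: "triple_mult (a, b, c) (a', b', c') = (a \<cdot> a', b \<cdot> b', c \<cdot> c')"
  by (simp add: triple_mult_def)

sublocale single: compact_right_semigroup maps "compose (topspace X)"
  unfolding maps_def using compact_phase_space Hausdorff_phase_space
  by (rule compact_right_semigroup_compose)

sublocale triple: compact_right_semigroup "prod_topology maps (prod_topology maps maps)" triple_mult
  unfolding triple_mult_def
  by (intro compact_right_semigroup_prod single.compact_right_semigroup_axioms)

text \<open>The Ellis semigroup. Presenting it as a generated closed subsemigroup reduces an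
  inclusion of \<open>E\<close> in a closed subsemigroup to a check on the maps
  \<open>act g\<close>.\<close>

definition E :: "('x \<Rightarrow> 'x) set" where
  "E = single.semigroup_closure (act ` carrier G)"

text \<open>
  The coordinates of a triple in \<open>S\<close> act on the vertices \<open>(0,1)\<close>, \<open>(1,0)\<close> and \<open>(0,0)\<close> of a
  square, leaving \<open>(1,1)\<close> fixed; the generators come from the hyperfaces avoiding \<open>(1,1)\<close>.
\<close>

definition S :: "(('x \<Rightarrow> 'x) \<times> ('x \<Rightarrow> 'x) \<times> ('x \<Rightarrow> 'x)) set" where
  "S = triple.semigroup_closure
    ((\<lambda>h. (act h, act \<one>, act h)) ` carrier G \<union> (\<lambda>h. (act \<one>, act h, act h)) ` carrier G)"

lemma topspace_maps: "topspace maps = topspace X \<rightarrow>\<^sub>E topspace X"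
  by (simp add: maps_def)

lemma act_maps: "g \<in> carrier G \<Longrightarrow> act g \<in> topspace maps"
  by (simp add: topspace_maps PiE_iff act_closed act_extensional)

lemma continuous_map_eval: "x \<in> topspace X \<Longrightarrow> continuous_map maps X (\<lambda>f. f x)"
  using continuous_map_product_projection[of x "topspace X" "\<lambda>_. X"] by (simp add: maps_def)

lemma closed_subsemigroup_E: "single.closed_subsemigroup E"
  unfolding E_def by (rule single.closed_subsemigroup_closure) (auto simp: act_maps)

lemma closed_subsemigroup_S: "triple.closed_subsemigroup S"
  unfolding S_def by (rule triple.closed_subsemigroup_closure) (auto simp: act_maps)

lemma S_generators:
  assumes "h \<in> carrier G"
  shows "(act h, act \<one>, act h) \<in> S" "(act \<one>, act h, act h) \<in> S"
  unfolding S_def using assms by (auto intro!: subsetD[OF triple.semigroup_closure_subset])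

lemma act_E: "g \<in> carrier G \<Longrightarrow> act g \<in> E"
  unfolding E_def using single.semigroup_closure_subset by blast

lemma E_maps: "e \<in> E \<Longrightarrow> e \<in> topspace maps"
  using single.subsemigroup_in_topspace[OF closed_subsemigroup_E] .

lemma E_mult [simp]: "e \<in> E \<Longrightarrow> f \<in> E \<Longrightarrow> e \<cdot> f \<in> E"
  using closed_subsemigroup_E by (simp add: single.closed_subsemigroup_def)

lemma E_assoc: "e \<in> E \<Longrightarrow> f \<in> E \<Longrightarrow> h \<in> E \<Longrightarrow> e \<cdot> f \<cdot> h = e \<cdot> (f \<cdot> h)"
  by (intro single.mul_assoc E_maps)

lemma E_apply: "e \<in> E \<Longrightarrow> x \<in> topspace X \<Longrightarrow> e x \<in> topspace X"
  using E_maps by (auto simp: topspace_maps)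

lemma composition_apply: "x \<in> topspace X \<Longrightarrow> (e \<cdot> f) x = e (f x)"
  by (simp add: compose_def)

lemma act_one_composition:
  assumes "f \<in> topspace maps" shows "act \<one> \<cdot> f = f" "f \<cdot> act \<one> = f"
  using assms by (auto simp: topspace_maps compose_def PiE_iff extensional_def fun_eq_iff act_one)

lemma S_mult: "(a, b, c) \<in> S \<Longrightarrow> (a', b', c') \<in> S \<Longrightarrow> (a \<cdot> a', b \<cdot> b', c \<cdot> c') \<in> S"
  using closed_subsemigroup_S unfolding triple.closed_subsemigroup_def
  by (metis triple_mult_apply)

lemma S_subset: "S \<subseteq> E \<times> E \<times> E"
  unfolding S_def
proof (rule triple.semigroup_closure_minimal)
  show "triple.closed_subsemigroup (E \<times> E \<times> E)"
    using closed_subsemigroup_E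
    by (auto simp: triple.closed_subsemigroup_def single.closed_subsemigroup_def
        triple_mult_apply closedin_prod_Times_iff)
qed (auto simp: act_E)

text \<open>The maps \<open>e\<close> with the stated property form a closed subsemigroup, as
  preimage of \<open>S\<close> under a continuous multiplicative embedding, and it contains every
  \<open>act g\<close>.\<close>

lemma S_left: "e \<in> E \<Longrightarrow> (e, act \<one>, e) \<in> S"
  and S_right: "e \<in> E \<Longrightarrow> (act \<one>, e, e) \<in> S"
proof -
  have S: "closedin (prod_topology maps (prod_topology maps maps)) S"
    using closed_subsemigroup_S by (simp add: triple.closed_subsemigroup_def)
  have one: "continuous_map maps maps (\<lambda>e. act \<one>)"
    using act_maps by simp
  have "continuous_map maps (prod_topology maps (prod_topology maps maps)) (\<lambda>e. (e, act \<one>, e))"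
    "continuous_map maps (prod_topology maps (prod_topology maps maps)) (\<lambda>e. (act \<one>, e, e))"
    using one by (auto intro!: continuous_map_pairedI)
  note cl = this[THEN closedin_continuous_map_preimage, OF S]
  have id: "act \<one> \<cdot> act \<one> = act \<one>"
    using act_maps by (simp add: act_one_composition)
  have "single.closed_subsemigroup {e \<in> topspace maps. (e, act \<one>, e) \<in> S}"
    using cl(1) S_mult[of _ "act \<one>" _ _ "act \<one>"] single.mul_closed
    by (auto simp: single.closed_subsemigroup_def id)
  then have "E \<subseteq> {e \<in> topspace maps. (e, act \<one>, e) \<in> S}"
    unfolding E_def using act_maps S_generators
    by (intro single.semigroup_closure_minimal) auto
  then show "(e, act \<one>, e) \<in> S" if "e \<in> E" for e using that by blast
  have "single.closed_subsemigroup {e \<in> topspace maps. (act \<one>, e, e) \<in> S}"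
    using cl(2) S_mult[of "act \<one>" _ _ "act \<one>"] single.mul_closed
    by (auto simp: single.closed_subsemigroup_def id)
  then have "E \<subseteq> {e \<in> topspace maps. (act \<one>, e, e) \<in> S}"
    unfolding E_def using act_maps S_generators
    by (intro single.semigroup_closure_minimal) auto
  then show "(act \<one>, e, e) \<in> S" if "e \<in> E" for e using that by blast
qed

lemma S_product: "e \<in> E \<Longrightarrow> f \<in> E \<Longrightarrow> (e, f, e \<cdot> f) \<in> S"
  using S_mult[OF S_left S_right, of e f] by (simp add: act_one_composition E_maps)

text \<open>Multiplying the two kinds of triples in the opposite order reverses the third
  coordinate; comparison with \<open>S_product\<close> is what produces commutators in
  \<open>L\<close>.\<close>

lemma S_product': "e \<in> E \<Longrightarrow> f \<in> E \<Longrightarrow> (e, f, f \<cdot> e) \<in> S"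
  using S_mult[OF S_right S_left, of f e] by (simp add: act_one_composition E_maps)

text \<open>The set of all \<open>e x\<close> with \<open>e \<in> E\<close> is compact and contains
  the dense orbit of \<open>x\<close>.\<close>

lemma E_transitive:
  assumes x: "x \<in> topspace X" and y: "y \<in> topspace X"
  shows "\<exists>e\<in>E. e x = y"
proof -
  have "compactin maps E"
    using closed_subsemigroup_E single.compact
    by (simp add: single.closed_subsemigroup_def closedin_compact_space)
  then have "closedin X ((\<lambda>e. e x) ` E)"
    using continuous_map_eval[OF x] Hausdorff_phase_space
    by (intro compactin_imp_closedin) (auto intro: image_compactin)
  moreover have "orbit G act x \<subseteq> (\<lambda>e. e x) ` E"
    by (auto simp: orbit_def act_E)
  ultimately have "X closure_of (orbit G act x) \<subseteq> (\<lambda>e. e x) ` E"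
    by (simp add: closure_of_minimal)
  then show ?thesis using dense_orbit[OF x] y by auto
qed

section \<open>Action of triples on dynamical squares\<close>

definition corner_act ::
  "('x \<Rightarrow> 'x) \<times> ('x \<Rightarrow> 'x) \<times> ('x \<Rightarrow> 'x) \<Rightarrow> ((nat \<Rightarrow> nat) \<Rightarrow> 'x) \<Rightarrow> (nat \<Rightarrow> nat) \<Rightarrow> 'x" where
  "corner_act = (\<lambda>(a, b, c) k. \<lambda>\<omega>\<in>cube 2.
    if \<omega> 1 = 1 then (if \<omega> 2 = 1 then k \<omega> else b (k \<omega>)) else (if \<omega> 2 = 1 then a (k \<omega>) else c (k \<omega>)))"

lemma cubes_subset: "dynamical_cubes G X act 2 \<subseteq> cube 2 \<rightarrow>\<^sub>E topspace X"
  using closure_of_subset_topspace[of "cube_topology 2 X"]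
  by (auto simp: dynamical_cubes_def cube_topology_def)

text \<open>A Host-Kra element acts continuously and permutes the generating squares among
  themselves, so it preserves their closure.\<close>

lemma HK_cubes:
  assumes g: "g \<in> HK G 2" and k: "k \<in> dynamical_cubes G X act 2"
  shows "cube_act 2 act g k \<in> dynamical_cubes G X act 2"
proof -
  let ?O = "{cube_act 2 act g (cube_const 2 x) | g x. g \<in> HK G 2 \<and> x \<in> topspace X}"
  have gG: "h \<omega> \<in> carrier G" if "h \<in> HK G 2" "\<omega> \<in> cube 2" for h \<omega>
    using HK_subset_carrier[OF is_group, of 2] that by (auto simp: cube_group_def)
  have cont: "continuous_map (cube_topology 2 X) (cube_topology 2 X) (cube_act 2 act g)"
  proof -
    have "continuous_map (cube_topology 2 X) X (\<lambda>c. act (g \<omega>) (c \<omega>))" if "\<omega> \<in> cube 2" for \<omega>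
      using continuous_map_compose[OF continuous_map_vertex[OF that] continuous_act[OF gG[OF g that]]]
      by (simp add: o_def)
    moreover have "cube_topology 2 X = product_topology (\<lambda>_. X) (cube 2)"
      by (simp add: cube_topology_def)
    ultimately show ?thesis
      by (auto simp: continuous_map_componentwise cube_act_def)
  qed
  have "cube_act 2 act g ` ?O \<subseteq> ?O"
  proof
    fix c assume "c \<in> cube_act 2 act g ` ?O"
    then obtain h x where h: "h \<in> HK G 2" "x \<in> topspace X"
      and c: "c = cube_act 2 act g (cube_act 2 act h (cube_const 2 x))" by auto
    have "c = cube_act 2 act (g \<otimes>\<^bsub>cube_group 2 G\<^esub> h) (cube_const 2 x)"
      unfolding c using gG g h
      by (intro ext) (auto simp: cube_act_def cube_const_def cube_group_def act_mult)
    moreover have "g \<otimes>\<^bsub>cube_group 2 G\<^esub> h \<in> HK G 2"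
      using g h(1) unfolding HK_def by (rule generate.eng)
    ultimately show "c \<in> ?O" using h(2) by blast
  qed
  then have "cube_topology 2 X closure_of (cube_act 2 act g ` ?O) \<subseteq> cube_topology 2 X closure_of ?O"
    by (rule closure_of_mono)
  moreover have "cube_act 2 act g ` (cube_topology 2 X closure_of ?O) \<subseteq> cube_topology 2 X closure_of (cube_act 2 act g ` ?O)"
    using cont by (rule continuous_map_image_closure_subset)
  ultimately show ?thesis
    using k unfolding dynamical_cubes_def by blast
qed

lemma face_cubes:
  assumes "h \<in> carrier G" "i \<in> {1..2}" "a \<in> {0, 1}" "k \<in> dynamical_cubes G X act 2"
  shows "cube_act 2 act (face_elem G 2 h (hyperface 2 i a)) k \<in> dynamical_cubes G X act 2"
  using assms by (intro HK_cubes) (auto simp: HK_def intro!: generate.incl)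

lemma corner_act_cubes:
  assumes s: "s \<in> S" and k: "k \<in> dynamical_cubes G X act 2"
  shows "corner_act s k \<in> dynamical_cubes G X act 2"
proof -
  let ?C = "dynamical_cubes G X act 2" and ?Z = "prod_topology maps (prod_topology maps maps)"
  define F where "F = {s \<in> topspace ?Z. \<forall>k\<in>?C. corner_act s k \<in> ?C}"
  have kX: "k \<omega> \<in> topspace X" if "k \<in> ?C" "\<omega> \<in> cube 2" for k \<omega>
    using cubes_subset that by blast
  have "S \<subseteq> F"
    unfolding S_def
  proof (rule triple.semigroup_closure_minimal)
    have "closedin ?Z {s \<in> topspace ?Z. corner_act s k \<in> ?C}" if k: "k \<in> ?C" for k
    proof (rule closedin_continuous_map_preimage)
      show "closedin (cube_topology 2 X) ?C" by (simp add: dynamical_cubes_def)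
      have eval: "continuous_map ?Z X (\<lambda>s. (fst s) x)" "continuous_map ?Z X (\<lambda>s. (fst (snd s)) x)"
        "continuous_map ?Z X (\<lambda>s. (snd (snd s)) x)" if x: "x \<in> topspace X" for x
        using continuous_map_compose[OF continuous_map_fst continuous_map_eval[OF x], unfolded o_def]
          continuous_map_compose[OF continuous_map_compose[OF continuous_map_snd continuous_map_fst]
            continuous_map_eval[OF x], unfolded o_def]
          continuous_map_compose[OF continuous_map_compose[OF continuous_map_snd continuous_map_snd]
            continuous_map_eval[OF x], unfolded o_def] by blast+
      have "continuous_map ?Z X (\<lambda>s. corner_act s k \<omega>)" if \<omega>: "\<omega> \<in> cube 2" for \<omega>
        unfolding corner_act_def case_prod_unfold using \<omega> kX[OF k \<omega>] eval[OF kX[OF k \<omega>]]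
        by (cases "\<omega> 1 = 1"; cases "\<omega> 2 = 1") simp_all
      then show "continuous_map ?Z (cube_topology 2 X) (\<lambda>s. corner_act s k)"
        unfolding cube_topology_def continuous_map_componentwise
        by (auto simp: corner_act_def case_prod_unfold)
    qed
    \<comment> \<open>The extra factor \<open>topspace ?Z\<close> covers an empty family of squares,
      whose intersection would be the whole type.\<close>
    then have "closedin ?Z (topspace ?Z \<inter> (\<Inter>k\<in>?C. {s \<in> topspace ?Z. corner_act s k \<in> ?C}))"
    proof (cases "?C = {}")
      case False
      with \<open>\<And>k. k \<in> ?C \<Longrightarrow> _\<close> show ?thesis
        by (intro closedin_Int closedin_topspace closedin_Inter) (auto simp del: topspace_prod_topology)
    qed (use closedin_topspace[of ?Z] in \<open>simp del: topspace_prod_topology\<close>)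
    moreover have "F = topspace ?Z \<inter> (\<Inter>k\<in>?C. {s \<in> topspace ?Z. corner_act s k \<in> ?C})"
      by (auto simp: F_def)
    moreover have "triple_mult s t \<in> F" if s: "s \<in> F" and t: "t \<in> F" for s t
    proof -
      have "corner_act (triple_mult s t) k = corner_act s (corner_act t k)" if k: "k \<in> ?C" for k
        using kX[OF k] by (intro ext)
          (auto simp: corner_act_def triple_mult_def composition_apply split: prod.split)
      moreover have "triple_mult s t \<in> topspace ?Z"
        using s t by (intro triple.mul_closed) (simp_all add: F_def)
      ultimately show ?thesis using s t by (simp add: F_def)
    qed
    ultimately show "triple.closed_subsemigroup F"
      by (simp add: triple.closed_subsemigroup_def)
    have val: "\<omega> i = 0 \<or> \<omega> i = 1" if "\<omega> \<in> cube 2" "i \<in> {1..2}" for \<omega> i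
      using that by (auto simp: cube_def)
    have "corner_act (act h, act \<one>, act h) k \<in> ?C" if h: "h \<in> carrier G" and k: "k \<in> ?C" for h k
    proof -
      have "corner_act (act h, act \<one>, act h) k = cube_act 2 act (face_elem G 2 h (hyperface 2 1 0)) k"
        using val[of _ 1] kX[OF k] by (intro ext)
          (force simp: corner_act_def cube_act_def face_elem_def hyperface_def act_one)
      then show ?thesis using face_cubes[OF h _ _ k] by simp
    qed
    moreover have "corner_act (act \<one>, act h, act h) k \<in> ?C" if h: "h \<in> carrier G" and k: "k \<in> ?C" for h k
    proof -
      have "corner_act (act \<one>, act h, act h) k = cube_act 2 act (face_elem G 2 h (hyperface 2 2 0)) k"
        using val[of _ 2] kX[OF k] by (intro ext)
          (force simp: corner_act_def cube_act_def face_elem_def hyperface_def act_one)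
      then show ?thesis using face_cubes[OF h _ _ k] by simp
    qed
    ultimately show "(\<lambda>h. (act h, act \<one>, act h)) ` carrier G \<union> (\<lambda>h. (act \<one>, act h, act h)) ` carrier G \<subseteq> F"
      by (auto simp: F_def act_maps)
  qed
  then show ?thesis using s k by (auto simp: F_def)
qed

text \<open>The triple is applied to the constant square at \<open>x\<close>. The vertex (1,1) keeps
  the value \<open>x\<close> and the others become \<open>y\<close>, hence the reversed
  pair.\<close>

lemma NRP1_if_S:
  assumes x: "x \<in> topspace X" and y: "y \<in> topspace X"
    and s: "(a, b, c) \<in> S" "a x = y" "b x = y" "c x = y"
  shows "(y, x) \<in> NRP1 G X act"
proof -
  have "\<one>\<^bsub>cube_group 2 G\<^esub> \<in> HK G 2"
    unfolding HK_def by (rule generate.one)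
  moreover have "cube_const 2 x = cube_act 2 act \<one>\<^bsub>cube_group 2 G\<^esub> (cube_const 2 x)"
    using x by (auto simp: cube_act_def cube_const_def cube_group_def act_one fun_eq_iff)
  ultimately have "cube_const 2 x \<in> {cube_act 2 act g (cube_const 2 x) | g x. g \<in> HK G 2 \<and> x \<in> topspace X}"
    using x by blast
  moreover have "{cube_act 2 act g (cube_const 2 x) | g x. g \<in> HK G 2 \<and> x \<in> topspace X} \<subseteq> topspace (cube_topology 2 X)"
    using HK_subset_carrier[OF is_group, of 2]
    by (fastforce simp: cube_topology_def cube_act_def cube_const_def cube_group_def intro!: act_closed)
  ultimately have "cube_const 2 x \<in> dynamical_cubes G X act 2"
    unfolding dynamical_cubes_def using closure_of_subset by blast
  from corner_act_cubes[OF s(1) this]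
  have "corner_act (a, b, c) (cube_const 2 x) \<in> dynamical_cubes G X act 2" .
  moreover have "corner_act (a, b, c) (cube_const 2 x) = lower_corner y x"
    using s(2-4) by (auto simp: corner_act_def cube_const_def lower_corner_def fun_eq_iff)
  ultimately show ?thesis using x y by (simp add: NRP1_def)
qed

end


section \<open>The abelian coordinate\<close>

locale based_system = enveloping_semigroup G T X act
  for G :: "('g, 'm) monoid_scheme" (structure) and T and X :: "'x topology" and act +
  fixes u :: "'x \<Rightarrow> 'x" and x0 :: 'x
  assumes u_minimal: "single.minimal_idempotent E u"
    and x0: "x0 \<in> topspace X" "u x0 = x0"
begin

definition Gam :: "('x \<Rightarrow> 'x) monoid" where
  "Gam = \<lparr>carrier = {p \<in> E. u \<cdot> p = p \<and> p \<cdot> u = p}, mult = (\<cdot>), one = u\<rparr>"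

lemma Gam_simps [simp]: "\<one>\<^bsub>Gam\<^esub> = u" "p \<otimes>\<^bsub>Gam\<^esub> q = p \<cdot> q"
  by (simp_all add: Gam_def)

lemma Gam_iff: "p \<in> carrier Gam \<longleftrightarrow> p \<in> E \<and> u \<cdot> p = p \<and> p \<cdot> u = p"
  by (simp add: Gam_def)

lemma u_E [simp]: "u \<in> E" and u_idem [simp]: "u \<cdot> u = u"
  using u_minimal by (auto simp: single.minimal_idempotent_def)

lemma u_recurrent: "e \<in> E \<Longrightarrow> \<exists>f\<in>E. f \<cdot> (e \<cdot> u) = u"
  using u_minimal by (auto simp: single.minimal_idempotent_def)

lemma Gam_E: "p \<in> carrier Gam \<Longrightarrow> p \<in> E" by (simp add: Gam_iff)

lemma sandwich_Gam: "e \<in> E \<Longrightarrow> u \<cdot> e \<cdot> u \<in> carrier Gam"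
  by (simp add: Gam_iff E_assoc) (simp flip: E_assoc)

text \<open>Minimality of the left ideal of \<open>u\<close> provides \<open>e\<close> with
  \<open>e \<cdot> p = u\<close>, and cutting \<open>e\<close> down to
  \<open>u \<cdot> e \<cdot> u\<close> gives a left inverse inside the group.\<close>

lemma group_Gam: "group Gam"
proof (rule groupI)
  show "\<exists>q\<in>carrier Gam. q \<otimes>\<^bsub>Gam\<^esub> p = \<one>\<^bsub>Gam\<^esub>" if p: "p \<in> carrier Gam" for p
  proof -
    obtain e where e: "e \<in> E" "e \<cdot> p = u"
      using u_recurrent[of p] p by (auto simp: Gam_iff)
    have "u \<cdot> e \<cdot> u \<cdot> p = u"
      using e p by (simp add: Gam_iff E_assoc)
    then show ?thesis using sandwich_Gam[OF e(1)] by (intro bexI) simp_all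
  qed
  show "p \<otimes>\<^bsub>Gam\<^esub> q \<in> carrier Gam" if "p \<in> carrier Gam" "q \<in> carrier Gam" for p q
    using that E_assoc[of u p q] by (auto simp: Gam_iff E_assoc)
qed (auto simp: Gam_iff E_assoc)

sublocale Gam: group Gam by (rule group_Gam)

text \<open>Idempotents of one minimal left ideal are right identities for it: from
  \<open>e \<cdot> v = u\<close> one gets \<open>u \<cdot> v = e \<cdot> v \<cdot> v = u\<close>,
  and then \<open>f \<cdot> v = f \<cdot> u \<cdot> v = f\<close>.\<close>

lemma idempotent_absorb:
  assumes v: "v \<in> E" "v \<cdot> v = v" "v \<cdot> u = v"
  shows "u \<cdot> v = u" and "f \<in> E \<Longrightarrow> f \<cdot> u = f \<Longrightarrow> f \<cdot> v = f"
proof -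
  obtain e where e: "e \<in> E" "e \<cdot> v = u" using u_recurrent[OF v(1)] v by auto
  then show uv: "u \<cdot> v = u" using v E_assoc[OF e(1) v(1) v(1)] by simp
  show "f \<cdot> v = f" if "f \<in> E" "f \<cdot> u = f"
    using E_assoc[of f u v] that v uv by simp
qed

text \<open>The translate of \<open>S\<close> by \<open>(a, b, c)\<close> is a closed subsemigroup
  and contains an idempotent \<open>(p \<cdot> a, q \<cdot> b, r \<cdot> c)\<close> with
  \<open>(p, q, r) \<in> S\<close>. By \<open>idempotent_absorb\<close>, \<open>u\<close> times each
  coordinate is \<open>u\<close>, so \<open>u \<cdot> p \<cdot> u\<close> inverts \<open>a\<close>,
  and likewise for \<open>b\<close> and \<open>c\<close>. Multiplying \<open>(p, q, r)\<close> by
  \<open>(u, u, u)\<close> on both sides stays in \<open>S\<close>.\<close>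

lemma S_inverse:
  assumes S: "(a, b, c) \<in> S" and abc: "a \<in> carrier Gam" "b \<in> carrier Gam" "c \<in> carrier Gam"
  shows "(inv\<^bsub>Gam\<^esub> a, inv\<^bsub>Gam\<^esub> b, inv\<^bsub>Gam\<^esub> c) \<in> S"
proof -
  let ?Sd = "(\<lambda>s. triple_mult s (a, b, c)) ` S"
  have "triple.closed_subsemigroup ?Sd"
    using closed_subsemigroup_S S by (rule triple.closed_subsemigroup_translate)
  then obtain w where w: "w \<in> ?Sd" "triple_mult w w = w"
    using triple.idempotent_exists[of ?Sd] S by blast
  then obtain p q r where s: "(p, q, r) \<in> S" and "w = triple_mult (p, q, r) (a, b, c)" by auto
  then have idem: "p \<cdot> a \<cdot> (p \<cdot> a) = p \<cdot> a" "q \<cdot> b \<cdot> (q \<cdot> b) = q \<cdot> b" "r \<cdot> c \<cdot> (r \<cdot> c) = r \<cdot> c"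
    using w(2) by (auto simp: triple_mult_apply)
  have pqr: "p \<in> E" "q \<in> E" "r \<in> E" using s S_subset by auto
  have inverse: "inv\<^bsub>Gam\<^esub> d = u \<cdot> e \<cdot> u"
    if d: "d \<in> carrier Gam" and e: "e \<in> E" and idem: "e \<cdot> d \<cdot> (e \<cdot> d) = e \<cdot> d" for d e
  proof (rule Gam.inv_equality)
    have "u \<cdot> (e \<cdot> d) = u"
      using d e idem by (intro idempotent_absorb(1)) (auto simp: Gam_iff E_assoc)
    then show "u \<cdot> e \<cdot> u \<otimes>\<^bsub>Gam\<^esub> d = \<one>\<^bsub>Gam\<^esub>"
      using d e by (simp add: Gam_iff E_assoc)
  qed (use d e sandwich_Gam in auto)
  have "(u, u, u) \<in> S" using S_product[of u u] by simp
  from S_mult[OF S_mult[OF this s] this] show ?thesis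
    using inverse abc pqr idem by simp
qed

section \<open>The subgroup \<open>L\<close> and its abelian quotient\<close>

definition L :: "('x \<Rightarrow> 'x) set" where
  "L = {c \<in> carrier Gam. \<exists>a\<in>carrier Gam. \<exists>b\<in>carrier Gam. (a, b, c) \<in> S \<and> a x0 = x0 \<and> b x0 = x0}"

lemma Gam_inv_fix:
  assumes "a \<in> carrier Gam" "a x0 = x0" shows "(inv\<^bsub>Gam\<^esub> a) x0 = x0"
  using Gam.l_inv[OF assms(1)] composition_apply[of x0 "inv\<^bsub>Gam\<^esub> a" a] assms x0 by simp

lemma subgroup_L: "subgroup L Gam"
proof
  show "L \<subseteq> carrier Gam" by (auto simp: L_def)
  show "\<one>\<^bsub>Gam\<^esub> \<in> L"
    using S_product[of u u] x0 Gam.one_closed by (auto simp: L_def)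
  show "p \<otimes>\<^bsub>Gam\<^esub> q \<in> L" if pq: "p \<in> L" "q \<in> L" for p q
  proof -
    obtain a b where a: "p \<in> carrier Gam" "a \<in> carrier Gam" "b \<in> carrier Gam" "(a, b, p) \<in> S" "a x0 = x0" "b x0 = x0"
      using pq(1) by (auto simp: L_def)
    obtain a' b' where a': "q \<in> carrier Gam" "a' \<in> carrier Gam" "b' \<in> carrier Gam" "(a', b', q) \<in> S" "a' x0 = x0" "b' x0 = x0"
      using pq(2) by (auto simp: L_def)
    have "(a \<cdot> a', b \<cdot> b', p \<cdot> q) \<in> S" using a(4) a'(4) by (rule S_mult)
    moreover have "a \<cdot> a' \<in> carrier Gam" "b \<cdot> b' \<in> carrier Gam" "p \<cdot> q \<in> carrier Gam"
      using a a' Gam.m_closed by simp_all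
    moreover have "(a \<cdot> a') x0 = x0" "(b \<cdot> b') x0 = x0"
      using a a' x0 by (simp_all add: composition_apply)
    ultimately show ?thesis unfolding L_def Gam_simps by blast
  qed
  show "inv\<^bsub>Gam\<^esub> p \<in> L" if p: "p \<in> L" for p
    using p S_inverse Gam_inv_fix Gam.inv_closed unfolding L_def by blast
qed

text \<open>As \<open>(a, u, a)\<close> and \<open>(u, b, b)\<close> lie in \<open>S\<close>, the discrepancy of a triple from
  being \<open>(a, b, a \<cdot> b)\<close> is measured by an element of \<open>L\<close>.\<close>

lemma S_discrepancy:
  assumes S: "(a, b, c) \<in> S" and abc: "a \<in> carrier Gam" "b \<in> carrier Gam" "c \<in> carrier Gam"
  shows "c \<otimes>\<^bsub>Gam\<^esub> inv\<^bsub>Gam\<^esub> (a \<otimes>\<^bsub>Gam\<^esub> b) \<in> L"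
proof -
  have "(a, b, a \<cdot> b) \<in> S" using abc by (intro S_product) (simp_all add: Gam_E)
  moreover have "a \<cdot> b \<in> carrier Gam" using abc Gam.m_closed by simp
  ultimately have "(inv\<^bsub>Gam\<^esub> a, inv\<^bsub>Gam\<^esub> b, inv\<^bsub>Gam\<^esub> (a \<cdot> b)) \<in> S"
    using abc by (intro S_inverse)
  from S_mult[OF S this] have "(u, u, c \<cdot> inv\<^bsub>Gam\<^esub> (a \<cdot> b)) \<in> S"
    using abc Gam.r_inv by simp
  moreover have "c \<cdot> inv\<^bsub>Gam\<^esub> (a \<cdot> b) \<in> carrier Gam"
    using abc(3) \<open>a \<cdot> b \<in> carrier Gam\<close> Gam.m_closed Gam.inv_closed by (metis Gam_simps(2))
  ultimately show ?thesis
    using x0 Gam.one_closed by (auto simp: L_def)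
qed

lemma commutator_L:
  assumes "a \<in> carrier Gam" "b \<in> carrier Gam"
  shows "(b \<otimes>\<^bsub>Gam\<^esub> a) \<otimes>\<^bsub>Gam\<^esub> inv\<^bsub>Gam\<^esub> (a \<otimes>\<^bsub>Gam\<^esub> b) \<in> L"
  using S_discrepancy[OF S_product'[of a b]] assms Gam.m_closed[of b a] by (simp add: Gam_E)

text \<open>Containing all commutators suffices: the conjugate of \<open>l\<close> by
  \<open>p\<close> is the commutator of \<open>p\<close> and \<open>l\<close> times
  \<open>l\<close>.\<close>

sublocale L: normal L Gam
proof -
  have "p \<otimes>\<^bsub>Gam\<^esub> l \<otimes>\<^bsub>Gam\<^esub> inv\<^bsub>Gam\<^esub> p \<in> L" if p: "p \<in> carrier Gam" and l: "l \<in> L" for p l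
  proof -
    have lG: "l \<in> carrier Gam" using l subgroup.subset[OF subgroup_L] by blast
    have "p \<otimes>\<^bsub>Gam\<^esub> l \<otimes>\<^bsub>Gam\<^esub> inv\<^bsub>Gam\<^esub> (l \<otimes>\<^bsub>Gam\<^esub> p) \<otimes>\<^bsub>Gam\<^esub> l \<in> L"
      using subgroup.m_closed[OF subgroup_L commutator_L[OF lG p] l] .
    moreover have "p \<otimes>\<^bsub>Gam\<^esub> l \<otimes>\<^bsub>Gam\<^esub> inv\<^bsub>Gam\<^esub> (l \<otimes>\<^bsub>Gam\<^esub> p) \<otimes>\<^bsub>Gam\<^esub> l = p \<otimes>\<^bsub>Gam\<^esub> l \<otimes>\<^bsub>Gam\<^esub> inv\<^bsub>Gam\<^esub> p"
      using p lG by (simp add: Gam.inv_mult_group Gam.m_assoc del: Gam_simps)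
    ultimately show ?thesis by (simp del: Gam_simps)
  qed
  then show "normal L Gam"
    using subgroup_L by (simp add: Gam.normal_inv_iff del: Gam_simps)
qed

lemma coset_eq:
  assumes "p \<in> carrier Gam" "q \<in> carrier Gam"
  shows "L #>\<^bsub>Gam\<^esub> p = L #>\<^bsub>Gam\<^esub> q \<longleftrightarrow> p \<otimes>\<^bsub>Gam\<^esub> inv\<^bsub>Gam\<^esub> q \<in> L"
proof
  assume "L #>\<^bsub>Gam\<^esub> p = L #>\<^bsub>Gam\<^esub> q"
  then have "p \<in> L #>\<^bsub>Gam\<^esub> q" using Gam.rcos_self[OF assms(1) subgroup_L] by simp
  then show "p \<otimes>\<^bsub>Gam\<^esub> inv\<^bsub>Gam\<^esub> q \<in> L"
    by (rule L.rcos_module_imp[OF Gam.is_group assms(2)])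
next
  assume "p \<otimes>\<^bsub>Gam\<^esub> inv\<^bsub>Gam\<^esub> q \<in> L"
  then have "p \<in> L #>\<^bsub>Gam\<^esub> q"
    by (rule L.rcos_module_rev[OF Gam.is_group assms(2,1)])
  then show "L #>\<^bsub>Gam\<^esub> p = L #>\<^bsub>Gam\<^esub> q"
    using Gam.repr_independence[OF _ assms(2) subgroup_L] by simp
qed

abbreviation "B \<equiv> Gam Mod L"

lemma B_mult:
  "p \<in> carrier Gam \<Longrightarrow> q \<in> carrier Gam \<Longrightarrow>
    (L #>\<^bsub>Gam\<^esub> p) \<otimes>\<^bsub>B\<^esub> (L #>\<^bsub>Gam\<^esub> q) = L #>\<^bsub>Gam\<^esub> (p \<cdot> q)"
  using L.rcos_sum by simp

lemma comm_group_B: "comm_group B"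
proof (rule group.group_comm_groupI[OF L.factorgroup_is_group])
  fix C D assume "C \<in> carrier B" "D \<in> carrier B"
  then obtain p q where pq: "p \<in> carrier Gam" "q \<in> carrier Gam" "C = L #>\<^bsub>Gam\<^esub> p" "D = L #>\<^bsub>Gam\<^esub> q"
    by (auto simp: carrier_FactGroup)
  have "L #>\<^bsub>Gam\<^esub> (q \<otimes>\<^bsub>Gam\<^esub> p) = L #>\<^bsub>Gam\<^esub> (p \<otimes>\<^bsub>Gam\<^esub> q)"
    using commutator_L[OF pq(1,2)] pq Gam.m_closed by (subst coset_eq) (simp_all del: Gam_simps)
  then show "C \<otimes>\<^bsub>B\<^esub> D = D \<otimes>\<^bsub>B\<^esub> C"
    using pq B_mult by simp
qed

sublocale B: comm_group B by (rule comm_group_B)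

section \<open>The coordinates on \<open>E\<close> and on \<open>X\<close>\<close>

definition \<gamma> :: "('x \<Rightarrow> 'x) \<Rightarrow> ('x \<Rightarrow> 'x) set" where
  "\<gamma> e = L #>\<^bsub>Gam\<^esub> (u \<cdot> e \<cdot> u)"

text \<open>The target is \<open>u x\<close> because every \<open>p\<close> in \<open>Gam\<close>
  satisfies \<open>u (p x0) = p x0\<close>. Independence of the choice modulo \<open>L\<close> is
  part of \<open>\<beta>_apply\<close>.\<close>

definition \<beta> :: "'x \<Rightarrow> ('x \<Rightarrow> 'x) set" where
  "\<beta> x = L #>\<^bsub>Gam\<^esub> (SOME p. p \<in> carrier Gam \<and> p x0 = u x)"

lemma \<gamma>_closed: "e \<in> E \<Longrightarrow> \<gamma> e \<in> carrier B"
  by (auto simp: \<gamma>_def carrier_FactGroup sandwich_Gam)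

text \<open>Multiplying by \<open>(u, u, u)\<close> on both sides moves the triple into
  \<open>Gam\<close>, where \<open>S_discrepancy\<close> applies.\<close>

lemma S_\<gamma>:
  assumes S: "(a, b, c) \<in> S"
  shows "\<gamma> c = \<gamma> a \<otimes>\<^bsub>B\<^esub> \<gamma> b"
proof -
  have abc: "a \<in> E" "b \<in> E" "c \<in> E" using S S_subset by auto
  let ?s = "\<lambda>e. u \<cdot> e \<cdot> u"
  have uuu: "(u, u, u) \<in> S" using S_product[of u u] by simp
  have "(?s a, ?s b, ?s c) \<in> S" using S_mult[OF S_mult[OF uuu S] uuu] .
  from S_discrepancy[OF this] have "L #>\<^bsub>Gam\<^esub> ?s c = L #>\<^bsub>Gam\<^esub> (?s a \<otimes>\<^bsub>Gam\<^esub> ?s b)"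
    using abc sandwich_Gam Gam.m_closed by (subst coset_eq) (simp_all del: Gam_simps)
  then show ?thesis
    using abc sandwich_Gam B_mult by (simp add: \<gamma>_def)
qed

text \<open>The map \<open>e \<mapsto> u \<cdot> e \<cdot> u\<close> is in general not
  multiplicative on \<open>E\<close>; it becomes so modulo \<open>L\<close>, since
  \<open>(e, f, e \<cdot> f)\<close> lies in \<open>S\<close>.\<close>

lemma \<gamma>_mult:
  assumes e: "e \<in> E" and f: "f \<in> E"
  shows "\<gamma> (e \<cdot> f) = \<gamma> e \<otimes>\<^bsub>B\<^esub> \<gamma> f"
  using S_\<gamma>[OF S_product[OF e f]] .

text \<open>The triple \<open>(a, u, a)\<close> is a witness. This makes \<open>\<beta>\<close> well
  defined.\<close>

lemma stabilizer_L:
  assumes "a \<in> carrier Gam" "a x0 = x0"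
  shows "a \<in> L"
proof -
  have "(a, u, a) \<in> S" using S_product[of a u] assms(1) by (simp add: Gam_iff)
  then show ?thesis using assms x0(2) Gam.one_closed unfolding L_def Gam_simps by blast
qed

lemma \<beta>_apply:
  assumes e: "e \<in> E"
  shows "\<beta> (e x0) = \<gamma> e"
proof -
  define p where "p = (SOME p. p \<in> carrier Gam \<and> p x0 = u (e x0))"
  let ?q = "u \<cdot> e \<cdot> u"
  have q: "?q \<in> carrier Gam" "?q x0 = u (e x0)"
    using e x0 sandwich_Gam by (simp_all add: composition_apply)
  then have p: "p \<in> carrier Gam" "p x0 = u (e x0)"
    using someI[of "\<lambda>p. p \<in> carrier Gam \<and> p x0 = u (e x0)" ?q] by (simp_all add: p_def)
  have "(inv\<^bsub>Gam\<^esub> ?q \<cdot> p) x0 = (inv\<^bsub>Gam\<^esub> ?q \<cdot> ?q) x0"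
    using p q x0 by (simp add: composition_apply)
  also have "\<dots> = x0" using Gam.l_inv[OF q(1)] x0 by simp
  finally have "inv\<^bsub>Gam\<^esub> ?q \<otimes>\<^bsub>Gam\<^esub> p \<in> L"
    using p q Gam.m_closed[OF Gam.inv_closed[OF q(1)] p(1)] by (intro stabilizer_L) simp_all
  \<comment> \<open>Right cosets of \<open>L\<close> are compared by \<open>p\<close> times the
    inverse of \<open>?q\<close>; conjugation by \<open>?q\<close> brings the element to that
    form.\<close>
  then have "?q \<otimes>\<^bsub>Gam\<^esub> (inv\<^bsub>Gam\<^esub> ?q \<otimes>\<^bsub>Gam\<^esub> p) \<otimes>\<^bsub>Gam\<^esub> inv\<^bsub>Gam\<^esub> ?q \<in> L"
    by (rule L.inv_op_closed2[OF q(1)])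
  moreover have "?q \<otimes>\<^bsub>Gam\<^esub> (inv\<^bsub>Gam\<^esub> ?q \<otimes>\<^bsub>Gam\<^esub> p) = p"
    using p q by (simp add: Gam.m_assoc[symmetric] del: Gam_simps)
  ultimately have "L #>\<^bsub>Gam\<^esub> p = L #>\<^bsub>Gam\<^esub> ?q"
    using p q by (simp add: coset_eq)
  then show ?thesis by (simp add: \<beta>_def \<gamma>_def p_def)
qed

lemma \<gamma>_u: "\<gamma> u = \<one>\<^bsub>B\<^esub>"
  using Gam.coset_mult_one[of L] L.subset by (simp add: \<gamma>_def)

lemma \<beta>_x0: "\<beta> x0 = \<one>\<^bsub>B\<^esub>"
  using \<beta>_apply[OF u_E] x0 \<gamma>_u by simp

lemma minimal_ideal_transitive:
  assumes "x \<in> topspace X"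
  obtains e where "e \<in> E" "e \<cdot> u = e" "e x0 = x"
proof -
  obtain e where e: "e \<in> E" "e x0 = x" using E_transitive[OF x0(1) assms] by blast
  show ?thesis
  proof (rule that)
    show "e \<cdot> u \<in> E" "e \<cdot> u \<cdot> u = e \<cdot> u" "(e \<cdot> u) x0 = x"
      using e x0 by (simp_all add: E_assoc composition_apply)
  qed
qed

text \<open>Write \<open>x = e x0\<close> and \<open>y = f x0\<close> with \<open>e\<close>,
  \<open>f\<close> in the left ideal of \<open>u\<close>, so that \<open>p = u \<cdot> e\<close> and
  \<open>q = u \<cdot> f\<close> lie in \<open>Gam\<close>. Equal coordinates put
  \<open>?q \<cdot> p\<close> in \<open>L\<close>, giving a triple of \<open>S\<close> whose first
  two entries fix \<open>x0\<close>. Surrounding it by \<open>S_product\<close> triples for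
  \<open>f\<close> and \<open>?p\<close> makes the first two coordinates travel from
  \<open>x\<close> through \<open>x0\<close> to \<open>y\<close>.\<close>

lemma equal_coordinates_imp_S:
  assumes x: "x \<in> topspace X" and y: "y \<in> topspace X" and \<beta>: "\<beta> x = \<beta> y"
  shows "\<exists>a b c. (a, b, c) \<in> S \<and> a x = y \<and> b x = y \<and> c x = y"
proof -
  obtain e where e: "e \<in> E" "e \<cdot> u = e" "e x0 = x" using x by (rule minimal_ideal_transitive)
  obtain f where f: "f \<in> E" "f \<cdot> u = f" "f x0 = y" using y by (rule minimal_ideal_transitive)
  define p where "p = u \<cdot> e"
  define q where "q = u \<cdot> f"
  have p: "p \<in> carrier Gam" and q: "q \<in> carrier Gam"
    using sandwich_Gam[OF e(1)] sandwich_Gam[OF f(1)] e f by (simp_all add: p_def q_def E_assoc)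
  let ?p = "inv\<^bsub>Gam\<^esub> p" and ?q = "inv\<^bsub>Gam\<^esub> q"
  have p': "?p \<in> carrier Gam" and q': "?q \<in> carrier Gam" using p q by simp_all
  note in_E = e(1) f(1) Gam_E[OF p] Gam_E[OF q] Gam_E[OF p'] Gam_E[OF q']
  have "L #>\<^bsub>Gam\<^esub> p = L #>\<^bsub>Gam\<^esub> q"
    using \<beta> \<beta>_apply[OF e(1)] \<beta>_apply[OF f(1)] e f by (simp add: \<gamma>_def p_def q_def E_assoc)
  then have "p \<otimes>\<^bsub>Gam\<^esub> ?q \<in> L" using p q by (simp add: coset_eq)
  then have "?q \<otimes>\<^bsub>Gam\<^esub> (p \<otimes>\<^bsub>Gam\<^esub> ?q) \<otimes>\<^bsub>Gam\<^esub> q \<in> L"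
    using L.inv_op_closed1[OF q] by blast
  moreover have "?q \<otimes>\<^bsub>Gam\<^esub> (p \<otimes>\<^bsub>Gam\<^esub> ?q) \<otimes>\<^bsub>Gam\<^esub> q = ?q \<otimes>\<^bsub>Gam\<^esub> p"
    using p q by (simp add: Gam.m_assoc del: Gam_simps)
  ultimately have "?q \<cdot> p \<in> L" by simp
  then obtain a b where ab: "a \<in> carrier Gam" "b \<in> carrier Gam" "(a, b, ?q \<cdot> p) \<in> S" "a x0 = x0" "b x0 = x0"
    unfolding L_def by blast
  have pe: "?p x = x0"
  proof -
    have "?p \<cdot> e = ?p \<cdot> p"
      using p' e in_E E_assoc[of ?p u e] by (simp add: p_def Gam_iff)
    then have "(?p \<cdot> e) x0 = x0" using Gam.l_inv[OF p] x0 by simp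
    then show ?thesis using e x0 by (simp add: composition_apply)
  qed
  \<comment> \<open>The outer factors are \<open>(f, f, f \<cdot> f)\<close> and
    \<open>(?p, ?p, ?p \<cdot> ?p)\<close>. The middle entry \<open>?q \<cdot> p\<close> is chosen
    so that it cancels one \<open>?p\<close> and supplies a \<open>?q\<close> next to
    \<open>f\<close>.\<close>
  have "(f \<cdot> a \<cdot> ?p, f \<cdot> b \<cdot> ?p, f \<cdot> f \<cdot> (?q \<cdot> p) \<cdot> (?p \<cdot> ?p)) \<in> S"
    using in_E ab(3) by (intro S_mult) (auto intro: S_product)
  moreover have "(f \<cdot> a \<cdot> ?p) x = y" "(f \<cdot> b \<cdot> ?p) x = y"
    using pe ab f x x0(1) by (simp_all add: composition_apply)
  moreover have "(f \<cdot> f \<cdot> (?q \<cdot> p) \<cdot> (?p \<cdot> ?p)) x = y"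
  proof -
    \<comment> \<open>Since \<open>?q \<cdot> f = u\<close>, \<open>?v\<close> is an idempotent of
      the left ideal of \<open>u\<close>, hence a right identity for \<open>f\<close>; so
      \<open>f (f (?q x0)) = f x0 = y\<close>.\<close>
    let ?v = "f \<cdot> ?q"
    have qf: "?q \<cdot> f = u"
    proof -
      have "?q \<cdot> f = ?q \<cdot> q"
        using q' f in_E E_assoc[of ?q u f] by (simp add: q_def Gam_iff)
      then show ?thesis using Gam.l_inv[OF q] by simp
    qed
    have "?v \<cdot> ?v = f \<cdot> (?q \<cdot> f \<cdot> ?q)" using in_E by (simp add: E_assoc)
    then have "?v \<cdot> ?v = ?v" using q' by (simp add: qf Gam_iff)
    moreover have "?v \<cdot> u = ?v" using in_E q' by (simp add: E_assoc Gam_iff)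
    moreover have "?v \<in> E" using in_E by simp
    ultimately have fv: "f \<cdot> ?v = f"
      using idempotent_absorb(2)[OF _ _ _ f(1,2), of ?v] by blast
    have pp: "p (?p x0) = x0"
      using Gam.r_inv[OF p] composition_apply[of x0 p ?p] x0 by simp
    have "(f \<cdot> f \<cdot> (?q \<cdot> p) \<cdot> (?p \<cdot> ?p)) x = f (f (?q (p (?p (?p x)))))"
      using x in_E E_apply by (simp add: composition_apply)
    also have "\<dots> = (f \<cdot> ?v) x0"
      using pe pp x0 E_apply in_E by (simp add: composition_apply)
    finally show ?thesis using fv f by simp
  qed
  ultimately show ?thesis by blast
qed

section \<open>The graph \<open>W\<close> and the identification of the relation\<close>

definition W :: "('x \<times> 'x \<times> 'x) set" where
  "W = (\<lambda>(a, b, c). (a x0, b x0, c x0)) ` S"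

lemma compactin_W: "compactin (prod_topology X (prod_topology X X)) W"
  unfolding W_def
proof (rule image_compactin)
  let ?Z = "prod_topology maps (prod_topology maps maps)"
  show "compactin ?Z S"
    using closed_subsemigroup_S triple.compact
    by (simp add: triple.closed_subsemigroup_def closedin_compact_space)
  have "continuous_map ?Z (prod_topology X (prod_topology X X))
      (\<lambda>s. (fst s x0, fst (snd s) x0, snd (snd s) x0))"
    using continuous_map_compose[OF continuous_map_fst continuous_map_eval[OF x0(1)], unfolded o_def]
      continuous_map_compose[OF continuous_map_compose[OF continuous_map_snd continuous_map_fst]
        continuous_map_eval[OF x0(1)], unfolded o_def]
      continuous_map_compose[OF continuous_map_compose[OF continuous_map_snd continuous_map_snd]
        continuous_map_eval[OF x0(1)], unfolded o_def]
    by (intro continuous_map_pairedI)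
  then show "continuous_map ?Z (prod_topology X (prod_topology X X)) (\<lambda>(a, b, c). (a x0, b x0, c x0))"
    by (simp add: case_prod_unfold)
qed

sublocale coordinate: abelian_coordinate G T X act B "\<lambda>g. \<gamma> (act g)" \<beta> W
proof
  show "\<gamma> (act g) \<in> carrier B" if "g \<in> carrier G" for g
    using that by (simp add: \<gamma>_closed act_E)
  show "\<beta> ` topspace X = carrier B"
  proof (intro equalityI subsetI)
    fix C assume "C \<in> \<beta> ` topspace X"
    then show "C \<in> carrier B"
      using \<beta>_apply \<gamma>_closed by (auto elim!: minimal_ideal_transitive)
  next
    fix C assume "C \<in> carrier B"
    then obtain p where p: "p \<in> carrier Gam" "C = L #>\<^bsub>Gam\<^esub> p" by (auto simp: carrier_FactGroup)
    then have "C = \<beta> (p x0)" using \<beta>_apply[OF Gam_E] by (simp add: \<gamma>_def Gam_iff)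
    then show "C \<in> \<beta> ` topspace X" using p x0 by (auto intro: E_apply Gam_E)
  qed
  show "\<beta> (act g x) = \<gamma> (act g) \<otimes>\<^bsub>B\<^esub> \<beta> x" if g: "g \<in> carrier G" and x: "x \<in> topspace X" for g x
  proof -
    obtain e where e: "e \<in> E" "e x0 = x" using x by (rule minimal_ideal_transitive)
    have "\<beta> ((act g \<cdot> e) x0) = \<gamma> (act g \<cdot> e)" using e g by (intro \<beta>_apply) (simp add: act_E)
    then show ?thesis
      using e x0 g \<gamma>_mult[OF act_E[OF g] e(1)] \<beta>_apply[OF e(1)] by (simp add: composition_apply)
  qed
  show "compactin (prod_topology X (prod_topology X X)) W" by (rule compactin_W)
  show mult: "\<beta> z = \<beta> x \<otimes>\<^bsub>B\<^esub> \<beta> y" if xyz: "(x, y, z) \<in> W" for x y z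
  proof -
    obtain a b c where abc: "(a, b, c) \<in> S" "x = a x0" "y = b x0" "z = c x0"
      using xyz by (auto simp: W_def)
    then have "a \<in> E" "b \<in> E" "c \<in> E" using S_subset by auto
    then show ?thesis using S_\<gamma>[OF abc(1)] abc by (simp add: \<beta>_apply)
  qed
  show "\<exists>z. (x, y, z) \<in> W" if x: "x \<in> topspace X" and y: "y \<in> topspace X" for x y
  proof -
    obtain e where e: "e \<in> E" "e x0 = x" using x by (rule minimal_ideal_transitive)
    obtain f where f: "f \<in> E" "f x0 = y" using y by (rule minimal_ideal_transitive)
    have "(\<lambda>(a, b, c). (a x0, b x0, c x0)) (e, f, e \<cdot> f) \<in> W"
      unfolding W_def using S_product[OF e(1) f(1)] by (rule imageI)
    then show ?thesis using e f by auto
  qed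
  show "closedin X {x \<in> topspace X. \<beta> x = \<one>\<^bsub>B\<^esub>}"
  proof -
    \<comment> \<open>The fibre of the unit is the diagonal slice of the compact set
      \<open>W\<close>: a point with the coordinate of \<open>x0\<close> is reached from
      \<open>x0\<close> by a triple of \<open>S\<close> with three equal values, and conversely an
      idempotent of a group is its unit.\<close>
    have "\<beta> x = \<one>\<^bsub>B\<^esub> \<longleftrightarrow> (x, x, x) \<in> W" if x: "x \<in> topspace X" for x
    proof
      assume "\<beta> x = \<one>\<^bsub>B\<^esub>"
      then obtain a b c where "(a, b, c) \<in> S" "a x0 = x" "b x0 = x" "c x0 = x"
        using equal_coordinates_imp_S[OF x0(1) x] \<beta>_x0 by auto
      then show "(x, x, x) \<in> W" unfolding W_def by force
    next
      assume "(x, x, x) \<in> W"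
      from mult[OF this] have "\<beta> x = \<beta> x \<otimes>\<^bsub>B\<^esub> \<beta> x" .
      moreover have "\<beta> x \<in> carrier B"
        using x \<beta>_apply \<gamma>_closed by (auto elim!: minimal_ideal_transitive)
      ultimately show "\<beta> x = \<one>\<^bsub>B\<^esub>" using B.r_cancel_one' by metis
    qed
    then have "{x \<in> topspace X. \<beta> x = \<one>\<^bsub>B\<^esub>} = {x \<in> topspace X. (x, x, x) \<in> W}" by auto
    moreover have "closedin X {x \<in> topspace X. (x, x, x) \<in> W}"
    proof (rule closedin_continuous_map_preimage)
      show "continuous_map X (prod_topology X (prod_topology X X)) (\<lambda>x. (x, x, x))"
        by (intro continuous_map_pairedI) simp_all
      show "closedin (prod_topology X (prod_topology X X)) W"
        using compactin_W Hausdorff_phase_space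
        by (intro compactin_imp_closedin) (simp_all add: Hausdorff_space_prod_topology)
    qed
    ultimately show ?thesis by simp
  qed
qed

text \<open>The quotient by \<open>fibres\<close> is an abelian group factor, so it collapses all
  pairs of \<open>NRP1\<close>. For the converse, the triple is taken from \<open>y\<close> to
  \<open>x\<close>, as \<open>NRP1_if_S\<close> reverses the pair.\<close>

lemma NRP1_eq_fibres: "NRP1 G X act = coordinate.fibres"
proof (intro equalityI subsetI)
  fix p assume p: "p \<in> NRP1 G X act"
  then obtain x y where xy: "p = (x, y)" "x \<in> topspace X" "y \<in> topspace X" by (auto simp: NRP1_def)
  have "coordinate.fibres `` {x} = coordinate.fibres `` {y}"
    using p xy(1) coordinate.congruence.factor_map_quotient
    by (intro NRP1_abelian_group_factor[OF tds_axioms coordinate.abelian_group_tds_quotient])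
      (auto simp: factor_map_def)
  then show "p \<in> coordinate.fibres"
    using xy coordinate.congruence.class_eq by simp
next
  fix p assume "p \<in> coordinate.fibres"
  then obtain x y where p: "p = (x, y)" "x \<in> topspace X" "y \<in> topspace X" "\<beta> y = \<beta> x"
    by (auto simp: coordinate.fibres_def)
  then show "p \<in> NRP1 G X act"
    using equal_coordinates_imp_S[OF p(3,2,4)] NRP1_if_S by blast
qed

end

section \<open>Nonempty and empty systems, and the universal property\<close>

lemma minimal_tds_NRP1:
  assumes minimal: "minimal_tds G T X act" and ne: "topspace X \<noteq> {}"
  shows "tds_congruence G T X act (NRP1 G X act)"
    and "abelian_group_tds G T (quotient_topology X (NRP1 G X act)) (quotient_act X (NRP1 G X act) act)"
proof -
  interpret minimal_tds G T X act by fact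
  interpret enveloping_semigroup G T X act ..
  have "E \<noteq> {}" using act_E[of "\<one>\<^bsub>G\<^esub>"] by blast
  then obtain u where u: "single.minimal_idempotent E u"
    using single.minimal_idempotent_exists[OF closed_subsemigroup_E] by blast
  obtain x where x: "x \<in> topspace X" using ne by blast
  have uE: "u \<in> E" "u \<cdot> u = u" using u by (auto simp: single.minimal_idempotent_def)
  \<comment> \<open>The base point \<open>u x\<close> is fixed by the idempotent
    \<open>u\<close>.\<close>
  interpret based_system G T X act u "u x"
    using u x E_apply[OF uE(1)] composition_apply[OF x, of u u] uE(2) by unfold_locales simp_all
  show "tds_congruence G T X act (NRP1 G X act)"
    unfolding NRP1_eq_fibres by (rule coordinate.congruence.tds_congruence_axioms)
  show "abelian_group_tds G T (quotient_topology X (NRP1 G X act)) (quotient_act X (NRP1 G X act) act)"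
    unfolding NRP1_eq_fibres by (rule coordinate.abelian_group_tds_quotient)
qed

text \<open>The empty system satisfies the density axiom vacuously but offers no base point.
  Extensionality leaves a single map on the empty set, and it forms the required group.\<close>

lemma abelian_group_tds_empty:
  fixes X :: "'x topology"
  assumes tds: "tds G T X act" and empty: "topspace X = {}"
  shows "abelian_group_tds G T X act"
proof -
  have auto: "tds_auto G X act = {\<lambda>_. undefined}"
    using empty by (auto simp: tds_auto_def Bij_def dynamical_morphism_def continuous_map_def bij_betw_def)
  let ?Aut = "tds_AutoGroup G X act" and ?i = "\<lambda>_. undefined :: 'x"
  have one: "\<one>\<^bsub>?Aut\<^esub> = ?i"
    by (simp add: tds_AutoGroup_def BijGroup_def empty restrict_def)
  have compose: "compose {} ?i ?i = ?i"
    by (simp add: compose_def restrict_def)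
  have "?i \<in> tds_auto G X act" by (simp add: auto)
  then have mult: "?i \<otimes>\<^bsub>?Aut\<^esub> ?i = ?i"
    by (simp only: tds_auto_mult empty compose)
  have "inv\<^bsub>?Aut\<^esub> ?i = ?i"
    by (intro tds_auto_inv) (simp_all add: auto compose empty restrict_def)
  then have "subgroup {?i} ?Aut"
    using one mult by (intro subgroup.intro) (simp_all add: tds_AutoGroup_def auto)
  moreover have "comm_group (?Aut\<lparr>carrier := {?i}\<rparr>)"
    using one mult by (intro comm_groupI) simp_all
  moreover have "compactin (uniform_topology X (tds_auto G X act)) {?i}"
    by (intro finite_imp_compactin) (simp_all add: topspace_uniform_topology auto)
  ultimately show ?thesis
    using tds empty unfolding abelian_group_tds_def by blast
qed

lemma tds_congruence_empty:
  assumes "tds G T X act" and empty: "topspace X = {}"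
  shows "tds_congruence G T X act (NRP1 G X act)"
proof -
  interpret tds G T X act by fact
  have "NRP1 G X act = {}" using empty by (auto simp: NRP1_def)
  then show ?thesis
    using empty by unfold_locales (auto simp: equiv_def refl_on_def sym_def trans_def)
qed

theorem theorem8p5:
  fixes G :: "('g, 'm) monoid_scheme" and T :: "'g topology"
    and X :: "'x topology" and act :: "'g \<Rightarrow> 'x \<Rightarrow> 'x"
  defines "R \<equiv> NRP1 G X act"
  defines "Q \<equiv> quotient_topology X R" and "actQ \<equiv> quotient_act X R act"
    and "\<pi>1 \<equiv> (\<lambda>x. R `` {x})"
  assumes "minimal_tds G T X act"
  shows "abelian_group_tds G T Q actQ
    \<and> factor_map G X act Q actQ \<pi>1
    \<and> (\<forall>(K :: 'k topology) actK \<phi>.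
        abelian_group_tds G T K actK \<and> factor_map G X act K actK \<phi> \<longrightarrow>
        (\<exists>\<psi>. dynamical_morphism G Q actQ K actK \<psi> \<and>
          (\<forall>x \<in> topspace X. \<phi> x = \<psi> (\<pi>1 x))))"
proof -
  interpret minimal_tds G T X act by fact
  have congruence: "tds_congruence G T X act R"
    using minimal_tds_NRP1(1)[OF assms(5)] tds_congruence_empty[OF tds_axioms] unfolding R_def by blast
  interpret tds_congruence G T X act R by (fact congruence)
  have topspace_Q: "topspace Q = \<pi>1 ` topspace X"
    unfolding Q_def \<pi>1_def using quotient_imp_surjective_map[OF quotient_map_quotient_topology] by metis
  have "abelian_group_tds G T Q actQ"
  proof (cases "topspace X = {}")
    case True
    then show ?thesis
      using tds_quotient topspace_Q by (intro abelian_group_tds_empty) (simp_all add: Q_def actQ_def)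
  next
    case False
    then show ?thesis
      using minimal_tds_NRP1(2)[OF assms(5)] by (simp add: Q_def actQ_def R_def)
  qed
  moreover have "factor_map G X act Q actQ \<pi>1"
    unfolding Q_def actQ_def \<pi>1_def by (rule factor_map_quotient)
  moreover have "\<exists>\<psi>. dynamical_morphism G Q actQ K actK \<psi> \<and> (\<forall>x \<in> topspace X. \<phi> x = \<psi> (\<pi>1 x))"
    if K: "abelian_group_tds G T K actK" and "factor_map G X act K actK \<phi>"
    for K :: "'k topology" and actK \<phi>
  proof -
    have \<phi>: "dynamical_morphism G X act K actK \<phi>"
      using that(2) by (simp add: factor_map_def)
    \<comment> \<open>Equality of classes is membership in \<open>NRP1\<close>, which
      \<open>\<phi>\<close> collapses; the quotient map then yields a continuous
      \<open>\<psi>\<close>.\<close>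
    have "\<phi> x = \<phi> y" if "x \<in> topspace X" "y \<in> topspace X" "\<pi>1 x = \<pi>1 y" for x y
      using that class_eq NRP1_abelian_group_factor[OF tds_axioms K \<phi>] by (simp add: \<pi>1_def R_def)
    moreover have "quotient_map X Q \<pi>1"
      unfolding Q_def \<pi>1_def by (rule quotient_map_quotient_topology)
    moreover have "continuous_map X K \<phi>" using \<phi> by (simp add: dynamical_morphism_def)
    ultimately obtain \<psi> where \<psi>: "continuous_map Q K \<psi>" "\<And>x. x \<in> topspace X \<Longrightarrow> \<psi> (\<pi>1 x) = \<phi> x"
      using quotient_map_lift_exists[of X Q \<pi>1 K \<phi>] by metis
    have "\<psi> (actQ g C) = actK g (\<psi> C)" if g: "g \<in> carrier G" and C: "C \<in> topspace Q" for g C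
    proof -
      obtain x where x: "x \<in> topspace X" "C = \<pi>1 x" using C topspace_Q by blast
      then have "actQ g C = \<pi>1 (act g x)"
        using g by (simp add: actQ_def \<pi>1_def quotient_act_class)
      then show ?thesis
        using x g \<psi>(2) \<phi> act_closed by (simp add: dynamical_morphism_def)
    qed
    then show ?thesis using \<psi> by (intro exI[of _ \<psi>]) (simp add: dynamical_morphism_def)
  qed
  ultimately show ?thesis by blast
qed

end
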